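(* Let $2<p<\infty$ and let $Y$ be a closed infinite-dimensional subspace of $JT_{2,p}$ that does not contain a subspace isomorphic to $\ell_p$. Then $Y$ is a complemented subspace of $JT_{2,p}$ and $Y$ is isomorphic to $\ell_2$.
   Context: $\mathbb N=\{1,2,\dots\}$. Fix a partial order $\preceq$ on $\mathbb N$, compatible with the usual order ($n\preceq m$ implies $n\le m$), defining an infinitely branching tree without root: the predecessors of each element are linearly ordered, there are infinitely many minimal elements, and every element has infinitely many immediate successors. A segment is a set $\{k\in\mathbb N: m\preceq k\preceq n\}$ with $m\preceq n$. $c_{00}(\mathbb N)$ is the space of finitely supported real sequences. For $2<p<\infty$, $JT_{2,p}$ is the completion of $c_{00}(\mathbb N)$ under the norm $$\|x\|=\sup\Big\{\Big(\sum_{k=1}^n\Big(\sum_{i\in s_k}x(i)^2\Big)^{p/2}\Big)^{1/p}: n\in\mathbb N,\ s_1,\dots,s_n \text{ pairwise disjoint segments}\Big\}.$$ Complemented means being the range of a bounded linear projection; isomorphic means linearly homeomorphic. *)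

theory Defs
  imports "HOL-Analysis.Analysis"
begin

(* The index set {1,2,...} is represented by the type nat: only its usual order matters,
   so shifting every index by one changes nothing. *)

definition immediate_succ :: "(nat \<Rightarrow> nat \<Rightarrow> bool) \<Rightarrow> nat \<Rightarrow> nat \<Rightarrow> bool" where
  "immediate_succ le m n \<longleftrightarrow>
     le m n \<and> m \<noteq> n \<and> (\<forall>k. le m k \<and> le k n \<longrightarrow> k = m \<or> k = n)"

definition tree_order :: "(nat \<Rightarrow> nat \<Rightarrow> bool) \<Rightarrow> bool" where
  "tree_order le \<longleftrightarrow>
     reflp le \<and> transp le \<and> antisymp le \<and>
     (\<forall>m n. le m n \<longrightarrow> m \<le> n) \<and>
     (\<forall>n k l. le k n \<and> le l n \<longrightarrow> le k l \<or> le l k) \<and>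
     infinite {n. \<forall>m. le m n \<longrightarrow> m = n} \<and>
     (\<forall>m. infinite {n. immediate_succ le m n})"

definition segment :: "(nat \<Rightarrow> nat \<Rightarrow> bool) \<Rightarrow> nat set \<Rightarrow> bool" where
  "segment le s \<longleftrightarrow> (\<exists>m n. le m n \<and> s = {k. le m k \<and> le k n})"

definition c00 :: "(nat \<Rightarrow> real) set" where
  "c00 = {x. finite {i. x i \<noteq> 0}}"

definition jt_sums :: "(nat \<Rightarrow> nat \<Rightarrow> bool) \<Rightarrow> real \<Rightarrow> (nat \<Rightarrow> real) \<Rightarrow> real set" where
  "jt_sums le p x =
     {(\<Sum>k=1..n. (\<Sum>i\<in>s k. (x i)\<^sup>2) powr (p / 2)) powr (1 / p) | n s.
        n \<ge> 1 \<and> (\<forall>k\<in>{1..n}. segment le (s k)) \<and> disjoint_family_on s {1..n::nat}}"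

definition jt_norm :: "(nat \<Rightarrow> nat \<Rightarrow> bool) \<Rightarrow> real \<Rightarrow> (nat \<Rightarrow> real) \<Rightarrow> real" where
  "jt_norm le p x = Sup (jt_sums le p x)"

(* Sequences of reals do not form an instance of real_vector, so linearity of maps defined on
   sequence spaces is spelled out with pointwise operations. *)
definition seq_linear_on :: "(nat \<Rightarrow> real) set \<Rightarrow> ((nat \<Rightarrow> real) \<Rightarrow> 'a::real_vector) \<Rightarrow> bool" where
  "seq_linear_on S T \<longleftrightarrow>
     (\<forall>x\<in>S. \<forall>y\<in>S. T (\<lambda>i. x i + y i) = T x + T y) \<and>
     (\<forall>c. \<forall>x\<in>S. T (\<lambda>i. c * x i) = c *\<^sub>R T x)"

definition lin_on :: "'a::real_vector set \<Rightarrow> ('a \<Rightarrow> 'b::real_vector) \<Rightarrow> bool" where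
  "lin_on X P \<longleftrightarrow>
     (\<forall>x\<in>X. \<forall>y\<in>X. P (x + y) = P x + P y) \<and> (\<forall>c. \<forall>x\<in>X. P (c *\<^sub>R x) = c *\<^sub>R P x)"

(* X, with the norm of the ambient Banach space, is a completion of the normed space
   (c00, jt_norm le p), the embedding of c00 being J.  The ambient space is arbitrary and may be
   larger than X; a completion in its own right is the case X = UNIV. *)
definition JT_space ::
  "(nat \<Rightarrow> nat \<Rightarrow> bool) \<Rightarrow> real \<Rightarrow> ((nat \<Rightarrow> real) \<Rightarrow> 'a::banach) \<Rightarrow> 'a set \<Rightarrow> bool" where
  "JT_space le p J X \<longleftrightarrow>
     seq_linear_on c00 J \<and> (\<forall>x\<in>c00. norm (J x) = jt_norm le p x) \<and> X = closure (J ` c00)"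

definition lp_space :: "real \<Rightarrow> (nat \<Rightarrow> real) set" where
  "lp_space p = {x. summable (\<lambda>i. \<bar>x i\<bar> powr p)}"

definition lp_norm :: "real \<Rightarrow> (nat \<Rightarrow> real) \<Rightarrow> real" where
  "lp_norm p x = (\<Sum>i. \<bar>x i\<bar> powr p) powr (1 / p)"

definition lp_topology :: "real \<Rightarrow> (nat \<Rightarrow> real) topology" where
  "lp_topology p = Metric_space.mtopology (lp_space p) (\<lambda>x y. lp_norm p (\<lambda>i. x i - y i))"

(* linear homeomorphism; the inverse of a linear bijection is automatically linear *)
definition isomorphic_to_lp :: "real \<Rightarrow> 'a::real_normed_vector set \<Rightarrow> bool" where
  "isomorphic_to_lp p Z \<longleftrightarrow>
     (\<exists>T. seq_linear_on (lp_space p) T \<and> homeomorphic_map (lp_topology p) (top_of_set Z) T)"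

definition infinite_dimensional :: "'a::real_vector set \<Rightarrow> bool" where
  "infinite_dimensional Y \<longleftrightarrow> \<not> (\<exists>B. finite B \<and> Y \<subseteq> span B)"

definition complemented_in :: "'a::real_normed_vector set \<Rightarrow> 'a set \<Rightarrow> bool" where
  "complemented_in X Y \<longleftrightarrow>
     (\<exists>P. lin_on X P \<and> (\<exists>K. \<forall>x\<in>X. norm (P x) \<le> K * norm x) \<and>
          P ` X = Y \<and> Y \<subseteq> X \<and> (\<forall>x\<in>X. P (P x) = P x))"

(* the supremum in jt_norm is a genuine one *)

lemma jt_sums_nonempty:
  assumes "tree_order le"
  shows "jt_sums le p x \<noteq> {}"
proof -
  define s where "s = (\<lambda>_::nat. {k. le 0 k \<and> le k 0})"
  have "reflp le" using assms unfolding tree_order_def by (rule conjunct1)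
  then have "le 0 0" by (rule reflpD)
  then have "\<forall>k\<in>{1..1}. segment le (s k)" unfolding segment_def s_def by blast
  moreover have "disjoint_family_on s {1..1}" by (simp add: disjoint_family_on_def)
  ultimately have "(\<Sum>k=1..1. (\<Sum>i\<in>s k. (x i)\<^sup>2) powr (p / 2)) powr (1 / p) \<in> jt_sums le p x"
    unfolding jt_sums_def by blast
  then show ?thesis by blast
qed

lemma jt_sums_bdd_above:
  assumes le: "tree_order le" and p: "p > 0" and x: "x \<in> c00"
  shows "bdd_above (jt_sums le p x)"
proof -
  define F where "F = {i. x i \<noteq> 0}"
  define M where "M = (\<Sum>i\<in>F. (x i)\<^sup>2) powr (p / 2)"
  have F: "finite F" using x by (simp add: F_def c00_def)
  have bound: "(\<Sum>k=1..n. (\<Sum>i\<in>s k. (x i)\<^sup>2) powr (p / 2)) powr (1 / p)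
          \<le> (real (card F) * M) powr (1 / p)"
    if seg: "\<forall>k\<in>{1..n}. segment le (s k)" and disj: "disjoint_family_on s {1..n}"
    for n :: nat and s
  proof -
    define A where "A = {k\<in>{1..n}. s k \<inter> F \<noteq> {}}"
    have fin: "finite (s k)" if k: "k \<in> {1..n}" for k
    proof -
      obtain a b where "s k = {j. le a j \<and> le j b}"
        using bspec[OF seg k] unfolding segment_def by blast
      moreover have "\<forall>j. le j b \<longrightarrow> j \<le> b" using le unfolding tree_order_def by blast
      ultimately have "s k \<subseteq> {..b}" by auto
      then show ?thesis using finite_subset by blast
    qed
    have eq: "(\<Sum>i\<in>s k. (x i)\<^sup>2) = (\<Sum>i\<in>s k \<inter> F. (x i)\<^sup>2)" if "k \<in> {1..n}" for k
      using fin[OF that] by (intro sum.mono_neutral_right) (auto simp: F_def)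
    have "\<forall>k\<in>A. \<exists>i. i \<in> s k \<inter> F" by (auto simp: A_def)
    then obtain f where f: "\<forall>k\<in>A. f k \<in> s k \<inter> F" by (rule bchoice[THEN exE])
    have "inj_on f A"
    proof (rule inj_onI, rule ccontr)
      fix k l assume kl: "k \<in> A" "l \<in> A" "f k = f l" "k \<noteq> l"
      then have "s k \<inter> s l = {}" using disj by (auto simp: A_def disjoint_family_on_def)
      moreover have "f k \<in> s k" using f kl(1) by blast
      moreover have "f k \<in> s l" unfolding kl(3) using f kl(2) by blast
      ultimately show False by blast
    qed
    then have cA: "card A \<le> card F" using f F by (intro card_inj_on_le[of f]) auto
    have "(\<Sum>k=1..n. (\<Sum>i\<in>s k. (x i)\<^sup>2) powr (p / 2))
        = (\<Sum>k\<in>A. (\<Sum>i\<in>s k. (x i)\<^sup>2) powr (p / 2))"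
      by (rule sum.mono_neutral_right) (auto simp: A_def eq)
    also have "\<dots> \<le> (\<Sum>k\<in>A. M)"
    proof (rule sum_mono)
      fix k assume "k \<in> A"
      then have "k \<in> {1..n}" by (simp add: A_def)
      moreover have "(\<Sum>i\<in>s k \<inter> F. (x i)\<^sup>2) \<le> (\<Sum>i\<in>F. (x i)\<^sup>2)"
        using F by (intro sum_mono2) auto
      ultimately show "(\<Sum>i\<in>s k. (x i)\<^sup>2) powr (p / 2) \<le> M"
        unfolding M_def using p by (auto simp: eq intro!: powr_mono2 sum_nonneg)
    qed
    also have "\<dots> \<le> real (card F) * M"
      using cA by (simp add: M_def mult_right_mono)
    finally show ?thesis using p by (intro powr_mono2) (auto intro!: sum_nonneg)
  qed
  show ?thesis
  proof (rule bdd_aboveI)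
    fix v assume "v \<in> jt_sums le p x"
    then obtain n :: nat and s where v: "v = (\<Sum>k=1..n. (\<Sum>i\<in>s k. (x i)\<^sup>2) powr (p / 2)) powr (1 / p)"
      and s: "\<forall>k\<in>{1..n}. segment le (s k)" "disjoint_family_on s {1..n}"
      unfolding jt_sums_def by blast
    show "v \<le> (real (card F) * M) powr (1 / p)" unfolding v using s by (rule bound)
  qed
qed

end

theory Submission
  imports Defs
begin

text \<open>
  Call a set \<open>F\<close> of nodes hilbertian if the \<open>\<ell>\<^sub>2\<close> norm of the restriction to \<open>F\<close> is dominated by the
  norm of the space; finite unions of branches have this property. If for some hilbertian \<open>F\<close> the
  restriction to \<open>F\<close> is bounded below on \<open>Y\<close>, then the inner product of \<open>\<ell>\<^sub>2(F)\<close>, extended to \<open>X\<close> by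
  continuity, makes \<open>Y\<close> a Hilbert space, and the orthogonal projection with respect to it is a bounded
  projection of \<open>X\<close> onto \<open>Y\<close>.

  Otherwise, unit vectors of \<open>Y\<close> may be chosen arbitrarily small on any prescribed hilbertian set.
  By compactness, the norms of such vectors on the subtrees above the nodes \<open>t\<close> have a common cluster
  point \<open>m(t)\<close>. The set of \<open>t\<close> with \<open>m(t) \<ge> \<delta>\<close> contains only antichains of bounded size, because the
  subtrees above incomparable nodes contribute to the norm in the \<open>\<ell>\<^sub>p\<close> sense; hence it is hilbertian.
  Choosing successive blocks that are small on these sets, and on the subtrees above the remaining nodes
  seen so far, one gets a sequence such that each segment meets at most two blocks in an essential way.
  Such a sequence is equivalent to the basis of \<open>\<ell>\<^sub>p\<close>.
\<close>

section \<open>Sequence spaces\<close>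

text \<open>Along a single branch the norm is Euclidean, so blocks that all stay visible on one
  branch add up there in the l_2 sense; this is what has to be excluded, for uncountably many
  branches at once, although smallness can be prescribed only on one hilbertian set at a time. The
  sets prescribed are level sets of \<open>m\<close> itself. This is not circular: \<open>m\<close>
  is a cluster point along all hilbertian sets and all tolerances simultaneously, so once
  \<open>m\<close> is known its own level sets may be prescribed, and there still are vectors, small
  on them, whose subtree norms are close to \<open>m\<close>. The common cluster point exists
  because hilbertian sets are closed under finite unions. The tolerance \<open>gap N\<close> depends
  on the position \<open>N\<close> where a block starts and not on the index of the block. Up to
  \<open>N\<close> disjoint segments can start before \<open>N\<close>, each of them adds an error
  of order \<open>gap N\<close>, and these errors must remain summable over the blocks.\<close>

lemma powr_convex_combination:
  fixes q t s u v :: real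
  assumes "1 \<le> q" "0 \<le> t" "0 \<le> s" "t + s = 1" "0 \<le> u" "0 \<le> v"
  shows "(t * u + s * v) powr q \<le> t * u powr q + s * v powr q"
proof -
  \<comment> \<open>Convexity is applied below only to positive \<open>u\<close> and
    \<open>v\<close>. If one of them vanishes, this inequality remains, and it holds because
    \<open>t powr q \<le> t\<close> on [0, 1].\<close>
  have *: "(t * u) powr q \<le> t * u powr q" if "0 \<le> t" "t \<le> 1" "0 \<le> u" for t u :: real
  proof -
    have "t powr q \<le> t"
    proof (cases "t = 0")
      case False
      then show ?thesis using powr_mono'[of 1 q t] that assms(1) by simp
    qed simp
    then show ?thesis using that by (simp add: powr_mult mult_right_mono)
  qed
  consider "u = 0" | "v = 0" | "u > 0" "v > 0" using assms by linarith
  then show ?thesis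
  proof cases
    case 1
    then show ?thesis using *[of s v] assms by simp
  next
    case 2
    then show ?thesis using *[of t u] assms by simp
  next
    case 3
    have "s = 1 - t" using assms by simp
    have "((1 - t) * v + t * u) powr q \<le> (1 - t) * v powr q + t * u powr q"
      using convex_onD[OF powr_convex[OF assms(1)], of t v u] 3 assms by simp
    then show ?thesis unfolding \<open>s = 1 - t\<close> by (simp add: add.commute)
  qed
qed

lemma lp_spaceD: "x \<in> lp_space q \<Longrightarrow> summable (\<lambda>i. \<bar>x i\<bar> powr q)"
  by (simp add: lp_space_def)

lemma lp_norm_nonneg [simp]: "0 \<le> lp_norm q x"
  by (simp add: lp_norm_def)

lemma lp_norm_powr:
  assumes "x \<in> lp_space q" "q > 0"
  shows "lp_norm q x powr q = (\<Sum>i. \<bar>x i\<bar> powr q)"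
  using assms suminf_nonneg[OF lp_spaceD[OF assms(1)]] by (simp add: lp_norm_def powr_powr)

lemma sum_le_lp_norm_powr:
  assumes "x \<in> lp_space q" "q > 0" "finite I"
  shows "(\<Sum>i\<in>I. \<bar>x i\<bar> powr q) \<le> lp_norm q x powr q"
  using assms by (simp add: lp_norm_powr lp_spaceD sum_le_suminf)

lemma abs_le_lp_norm:
  assumes "x \<in> lp_space q" "q > 0"
  shows "\<bar>x i\<bar> \<le> lp_norm q x"
  using sum_le_lp_norm_powr[OF assms, of "{i}"] powr_le_cancel_iff powr_less_mono2 assms(2)
  by (metis abs_ge_zero empty_iff finite.emptyI finite.insertI linorder_not_le lp_norm_nonneg sum.empty
      sum.insert add.right_neutral)

text \<open>A uniform bound on partial sums yields membership and the norm bound together;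
  Minkowski's inequality and the completeness argument for l_q are both run in this form.\<close>

lemma lp_norm_leI:
  assumes "q > 0" "K \<ge> 0" "\<And>N. (\<Sum>i<N. \<bar>x i\<bar> powr q) \<le> K powr q"
  shows "x \<in> lp_space q" "lp_norm q x \<le> K"
proof -
  have s: "summable (\<lambda>i. \<bar>x i\<bar> powr q)"
    by (rule bounded_imp_summable[where B = "K powr q"])
       (simp_all add: assms(3) lessThan_Suc_atMost[symmetric] del: sum.lessThan_Suc)
  then show "x \<in> lp_space q" by (simp add: lp_space_def)
  have "(\<Sum>i. \<bar>x i\<bar> powr q) \<le> K powr q"
    by (intro suminf_le_const s assms(3))
  then have "lp_norm q x \<le> (K powr q) powr (1 / q)"
    unfolding lp_norm_def using assms(1) suminf_nonneg[OF s] by (intro powr_mono2) auto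
  then show "lp_norm q x \<le> K" using assms by (simp add: powr_powr)
qed

lemma lp_norm_eq_0:
  assumes "x \<in> lp_space q" "q > 0"
  shows "lp_norm q x = 0 \<longleftrightarrow> (\<forall>i. x i = 0)"
  using abs_le_lp_norm[OF assms] by (force simp: lp_norm_def)

lemma lp_scale:
  assumes "x \<in> lp_space q" "q > 0"
  shows "(\<lambda>i. c * x i) \<in> lp_space q" "lp_norm q (\<lambda>i. c * x i) = \<bar>c\<bar> * lp_norm q x"
proof -
  have s: "summable (\<lambda>i. \<bar>x i\<bar> powr q)" using assms by (simp add: lp_spaceD)
  have eq: "\<bar>c * x i\<bar> powr q = \<bar>c\<bar> powr q * \<bar>x i\<bar> powr q" for i
    by (simp add: abs_mult powr_mult)
  show "(\<lambda>i. c * x i) \<in> lp_space q"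
    using s by (simp add: lp_space_def eq summable_mult)
  show "lp_norm q (\<lambda>i. c * x i) = \<bar>c\<bar> * lp_norm q x"
    using assms(2) suminf_nonneg[OF s]
    by (simp add: lp_norm_def eq suminf_mult[OF s] powr_mult powr_powr)
qed

text \<open>Minkowski's inequality from convexity: \<open>x + y\<close> is \<open>a + b\<close>
  times the convex combination of \<open>x / a\<close> and \<open>y / b\<close> with weights
  \<open>a / (a + b)\<close> and \<open>b / (a + b)\<close>. The cases \<open>a = 0\<close> and
  \<open>b = 0\<close> are split off because of the quotients.\<close>

lemma lp_add:
  assumes x: "x \<in> lp_space q" and y: "y \<in> lp_space q" and q: "q \<ge> 1"
  shows "(\<lambda>i. x i + y i) \<in> lp_space q"
    "lp_norm q (\<lambda>i. x i + y i) \<le> lp_norm q x + lp_norm q y"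
proof -
  define a b where "a = lp_norm q x" and "b = lp_norm q y"
  have q0: "q > 0" using q by simp
  have ab: "a \<ge> 0" "b \<ge> 0" by (simp_all add: a_def b_def)
  have "(\<Sum>i<N. \<bar>x i + y i\<bar> powr q) \<le> (a + b) powr q" for N
  proof -
    consider "a = 0" | "b = 0" | "a > 0" "b > 0" using ab by linarith
    then show ?thesis
    proof cases
      case 1
      then have "x = (\<lambda>_. 0)" using lp_norm_eq_0[OF x q0] a_def by auto
      then show ?thesis using sum_le_lp_norm_powr[OF y q0] 1 by (simp add: b_def)
    next
      case 2
      then have "y = (\<lambda>_. 0)" using lp_norm_eq_0[OF y q0] b_def by auto
      then show ?thesis using sum_le_lp_norm_powr[OF x q0] 2 by (simp add: a_def)
    next
      case 3
      then have ab0: "a + b \<noteq> 0" by simp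
      have "\<bar>x i + y i\<bar> powr q \<le> (a + b) powr q *
          (a / (a + b) * (\<bar>x i\<bar> powr q / a powr q) + b / (a + b) * (\<bar>y i\<bar> powr q / b powr q))" for i
      proof -
        have "\<bar>x i + y i\<bar> powr q \<le> (\<bar>x i\<bar> + \<bar>y i\<bar>) powr q"
          using q by (intro powr_mono2) auto
        also have "\<bar>x i\<bar> + \<bar>y i\<bar>
            = (a + b) * (a / (a + b) * (\<bar>x i\<bar> / a) + b / (a + b) * (\<bar>y i\<bar> / b))"
          using 3 ab0 by (simp add: distrib_left)
        also have "\<dots> powr q
            = (a + b) powr q * (a / (a + b) * (\<bar>x i\<bar> / a) + b / (a + b) * (\<bar>y i\<bar> / b)) powr q"
          using 3 by (intro powr_mult)
        also have "\<dots> \<le> (a + b) powr q *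
          (a / (a + b) * (\<bar>x i\<bar> / a) powr q + b / (a + b) * (\<bar>y i\<bar> / b) powr q)"
          using 3 q by (intro mult_left_mono powr_convex_combination) (auto simp: ab0 simp flip: add_divide_distrib)
        finally show ?thesis using 3 by (simp add: powr_divide)
      qed
      then have "(\<Sum>i<N. \<bar>x i + y i\<bar> powr q) \<le> (\<Sum>i<N. (a + b) powr q *
          (a / (a + b) * (\<bar>x i\<bar> powr q / a powr q) + b / (a + b) * (\<bar>y i\<bar> powr q / b powr q)))"
        by (rule sum_mono)
      also have "\<dots> = (a + b) powr q * (a / (a + b) * ((\<Sum>i<N. \<bar>x i\<bar> powr q) / a powr q)
            + b / (a + b) * ((\<Sum>i<N. \<bar>y i\<bar> powr q) / b powr q))"
        by (simp add: sum.distrib sum_distrib_left sum_divide_distrib distrib_left)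
      also have "\<dots> \<le> (a + b) powr q * (a / (a + b) * 1 + b / (a + b) * 1)"
        using 3 sum_le_lp_norm_powr[OF x q0, of "{..<N}"] sum_le_lp_norm_powr[OF y q0, of "{..<N}"]
        by (intro mult_left_mono add_mono) (auto simp: a_def b_def)
      also have "\<dots> = (a + b) powr q" using 3 by (simp flip: add_divide_distrib)
      finally show ?thesis .
    qed
  qed
  from lp_norm_leI[OF q0 _ this] ab
  show "(\<lambda>i. x i + y i) \<in> lp_space q" "lp_norm q (\<lambda>i. x i + y i) \<le> lp_norm q x + lp_norm q y"
    by (auto simp: a_def b_def)
qed

lemma lp_diff:
  assumes "x \<in> lp_space q" "y \<in> lp_space q" "q \<ge> 1"
  shows "(\<lambda>i. x i - y i) \<in> lp_space q"
  using lp_add(1)[OF assms(1) lp_scale(1)[OF assms(2), of "-1"] assms(3)] assms(3) by simp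

lemma Metric_space_lp:
  assumes "q \<ge> 1"
  shows "Metric_space (lp_space q) (\<lambda>x y. lp_norm q (\<lambda>i. x i - y i))"
proof
  fix x y z
  show "0 \<le> lp_norm q (\<lambda>i. x i - y i)" by simp
  show "lp_norm q (\<lambda>i. x i - y i) = lp_norm q (\<lambda>i. y i - x i)"
    by (simp add: lp_norm_def abs_minus_commute)
  assume x: "x \<in> lp_space q" and y: "y \<in> lp_space q"
  show "lp_norm q (\<lambda>i. x i - y i) = 0 \<longleftrightarrow> x = y"
    using lp_norm_eq_0[OF lp_diff[OF x y]] assms by (auto simp: fun_eq_iff)
  assume z: "z \<in> lp_space q"
  show "lp_norm q (\<lambda>i. x i - z i) \<le> lp_norm q (\<lambda>i. x i - y i) + lp_norm q (\<lambda>i. y i - z i)"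
    using lp_add(2)[OF lp_diff[OF x y] lp_diff[OF y z]] assms by simp
qed

lemma finite_support_lp_space:
  assumes "finite {i. x i \<noteq> 0}"
  shows "x \<in> lp_space q"
  unfolding lp_space_def by (simp, rule summable_finite[OF assms]) auto

section \<open>Isomorphisms from l_q given by two-sided estimates\<close>

lemma isomorphic_to_lpI:
  fixes T :: "(nat \<Rightarrow> real) \<Rightarrow> 'a::real_normed_vector"
  assumes q: "q \<ge> 1" and lin: "seq_linear_on (lp_space q) T" and c: "c > 0"
    and lower: "\<And>x. x \<in> lp_space q \<Longrightarrow> c * lp_norm q x \<le> norm (T x)"
    and upper: "\<And>x. x \<in> lp_space q \<Longrightarrow> norm (T x) \<le> C * lp_norm q x"
  shows "isomorphic_to_lp q (T ` lp_space q)"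
proof -
  define d where "d = (\<lambda>x y. lp_norm q (\<lambda>i. x i - y i))"
  define Z where "Z = T ` lp_space q"
  have T_diff: "T (\<lambda>i. x i - y i) = T x - T y" if "x \<in> lp_space q" "y \<in> lp_space q" for x y
  proof -
    have "(\<lambda>i. (- 1) * y i) \<in> lp_space q" using that q by (intro lp_scale) auto
    then have "T (\<lambda>i. x i + (- 1) * y i) = T x + T (\<lambda>i. (- 1) * y i)"
      using lin[unfolded seq_linear_on_def, THEN conjunct1, rule_format, of x "\<lambda>i. (- 1) * y i"] that
      by blast
    also have "T (\<lambda>i. (- 1) * y i) = (- 1) *\<^sub>R T y"
      using lin[unfolded seq_linear_on_def, THEN conjunct2, rule_format, of y "- 1"] that by blast
    finally show ?thesis by simp
  qed
  interpret M: Metric_space "lp_space q" d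
    unfolding d_def by (rule Metric_space_lp[OF q])
  interpret N: Submetric UNIV "dist :: 'a \<Rightarrow> 'a \<Rightarrow> real" Z
    by unfold_locales auto
  have topN: "N.sub.mtopology = top_of_set Z"
    by (simp add: N.mtopology_submetric)
  have low: "c * d x y \<le> dist (T x) (T y)" and up: "dist (T x) (T y) \<le> C * d x y"
    if "x \<in> lp_space q" "y \<in> lp_space q" for x y
    using lower[OF lp_diff[OF that q]] upper[OF lp_diff[OF that q]] T_diff[OF that]
    by (auto simp: dist_norm d_def)
  have inj: "inj_on T (lp_space q)"
  proof (rule inj_onI)
    fix x y assume *: "x \<in> lp_space q" "y \<in> lp_space q" "T x = T y"
    then have "c * d x y \<le> 0" using low[of x y] by simp
    then have "d x y \<le> 0" using c by (simp add: mult_le_0_iff)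
    then have "d x y = 0" using M.nonneg[of x y] by linarith
    then show "x = y" using * by simp
  qed
  define S where "S = the_inv_into (lp_space q) T"
  have S: "S (T x) = x" if "x \<in> lp_space q" for x
    using the_inv_into_f_f[OF inj that] by (simp add: S_def)
  have "continuous_map M.mtopology N.sub.mtopology T"
    unfolding M.metric_continuous_map[OF N.sub.Metric_space_axioms]
  proof (intro conjI ballI allI impI)
    show "T ` lp_space q \<subseteq> Z" by (simp add: Z_def)
    fix a and e :: real assume a: "a \<in> lp_space q" and e: "e > 0"
    show "\<exists>r>0. \<forall>x. x \<in> lp_space q \<and> d a x < r \<longrightarrow> dist (T a) (T x) < e"
    proof (intro exI conjI allI impI)
      \<comment> \<open>The sign of \<open>C\<close> is unrestricted;
        \<open>\<bar>C\<bar> + 1\<close> keeps the radius positive.\<close>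
      show "e / (\<bar>C\<bar> + 1) > 0" using e by simp
      fix x assume x: "x \<in> lp_space q \<and> d a x < e / (\<bar>C\<bar> + 1)"
      have "dist (T a) (T x) \<le> C * d a x" using up a x by blast
      also have "\<dots> \<le> (\<bar>C\<bar> + 1) * d a x" by (intro mult_right_mono) auto
      also have "\<dots> < e" using x by (simp add: field_simps)
      finally show "dist (T a) (T x) < e" .
    qed
  qed
  moreover have "continuous_map N.sub.mtopology M.mtopology S"
    unfolding N.sub.metric_continuous_map[OF M.Metric_space_axioms]
  proof (intro conjI ballI allI impI)
    show "S ` Z \<subseteq> lp_space q" by (auto simp: Z_def S)
    fix b and e :: real assume b: "b \<in> Z" and e: "e > 0"
    then obtain a where a: "a \<in> lp_space q" "b = T a" by (auto simp: Z_def)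
    show "\<exists>r>0. \<forall>y. y \<in> Z \<and> dist b y < r \<longrightarrow> d (S b) (S y) < e"
    proof (intro exI conjI allI impI)
      show "c * e > 0" using e c by simp
      fix y assume "y \<in> Z \<and> dist b y < c * e"
      then obtain x where x: "x \<in> lp_space q" "y = T x" "dist b y < c * e" by (auto simp: Z_def)
      have "c * d a x < c * e" using low[OF a(1) x(1)] x a by simp
      then show "d (S b) (S y) < e" using c x a by (simp add: S)
    qed
  qed
  ultimately have "homeomorphic_maps M.mtopology (top_of_set Z) T S"
    unfolding topN homeomorphic_maps_def by (auto simp: S Z_def)
  then show ?thesis
    unfolding isomorphic_to_lp_def lp_topology_def Z_def[symmetric] d_def[symmetric]
    using lin homeomorphic_maps_imp_map by blast
qed

text \<open>Estimates on finite sums suffice. The upper one makes the series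
  \<open>a n *\<^sub>R y n\<close> Cauchy, which defines \<open>T\<close> on all of l_q; the lower
  one makes the preimages of a convergent sequence Cauchy in l_q, so that the range is
  closed.\<close>

lemma isomorphic_to_lp_closure_span:
  fixes y :: "nat \<Rightarrow> 'a::banach"
  assumes q: "q \<ge> 1" and c: "c > 0" and C: "C \<ge> 0"
    and lower: "\<And>a N. c * (\<Sum>n<N. \<bar>a n\<bar> powr q) powr (1 / q) \<le> norm (\<Sum>n<N. a n *\<^sub>R y n)"
    and upper: "\<And>a N. norm (\<Sum>n<N. a n *\<^sub>R y n) \<le> C * (\<Sum>n<N. \<bar>a n\<bar> powr q) powr (1 / q)"
  shows "isomorphic_to_lp q (closure (span (range y)))"
proof -
  have q0: "q > 0" using q by simp
  have summ: "summable (\<lambda>n. a n *\<^sub>R y n)" if a: "a \<in> lp_space q" for a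
    unfolding summable_Cauchy
  proof (intro allI impI)
    fix e :: real assume e: "e > 0"
    define r where "r = (e / (C + 1)) powr q"
    have r: "r > 0" using e C by (simp add: r_def)
    obtain N where N: "\<And>m n. m \<ge> N \<Longrightarrow> norm (\<Sum>i=m..<n. \<bar>a i\<bar> powr q) < r"
      using lp_spaceD[OF a] r unfolding summable_Cauchy by meson
    show "\<exists>N. \<forall>m\<ge>N. \<forall>n. norm (\<Sum>i=m..<n. a i *\<^sub>R y i) < e"
    proof (intro exI[of _ N] allI impI)
      fix m n assume m: "m \<ge> N"
      \<comment> \<open>Setting the coefficients outside \<open>{m..<n}\<close> to 0 turns a middle
        section into an initial sum, the only kind of sum that \<open>upper\<close>
        controls.\<close>
      define a' where "a' = (\<lambda>i. if i \<in> {m..<n} then a i else 0)"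
      have 1: "(\<Sum>i=m..<n. a i *\<^sub>R y i) = (\<Sum>i<n. a' i *\<^sub>R y i)"
        by (rule sum.mono_neutral_cong_left) (auto simp: a'_def)
      have 2: "(\<Sum>i=m..<n. \<bar>a i\<bar> powr q) = (\<Sum>i<n. \<bar>a' i\<bar> powr q)"
        by (rule sum.mono_neutral_cong_left) (auto simp: a'_def)
      have "norm (\<Sum>i=m..<n. a i *\<^sub>R y i) \<le> C * (\<Sum>i=m..<n. \<bar>a i\<bar> powr q) powr (1 / q)"
        unfolding 1 2 by (rule upper)
      also have "\<dots> \<le> C * r powr (1 / q)"
        using N[OF m, of n] q C by (intro mult_left_mono powr_mono2) (auto intro!: sum_nonneg)
      also have "\<dots> = C * (e / (C + 1))" using e C q by (simp add: r_def powr_powr)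
      also have "\<dots> < e" using e C by (simp add: field_simps)
      finally show "norm (\<Sum>i=m..<n. a i *\<^sub>R y i) < e" .
    qed
  qed
  define T where "T = (\<lambda>a. \<Sum>n. a n *\<^sub>R y n)"
  have lim: "(\<lambda>N. \<Sum>n<N. a n *\<^sub>R y n) \<longlonglongrightarrow> T a" if "a \<in> lp_space q" for a
    using summable_LIMSEQ[OF summ[OF that]] by (simp add: T_def)
  have limn: "(\<lambda>N. (\<Sum>n<N. \<bar>a n\<bar> powr q) powr (1 / q)) \<longlonglongrightarrow> lp_norm q a"
    if "a \<in> lp_space q" for a
    unfolding lp_norm_def using q0
    by (intro tendsto_powr' summable_LIMSEQ lp_spaceD[OF that] tendsto_const)
       (auto intro!: sum_nonneg always_eventually)
  have lin: "seq_linear_on (lp_space q) T"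
    unfolding seq_linear_on_def T_def
    by (auto simp: scaleR_add_left summ suminf_add simp flip: scaleR_scaleR suminf_scaleR_right)
  have low: "c * lp_norm q a \<le> norm (T a)" if "a \<in> lp_space q" for a
    by (rule LIMSEQ_le[OF tendsto_mult[OF tendsto_const limn[OF that]] tendsto_norm[OF lim[OF that]]])
       (use lower in auto)
  have up: "norm (T a) \<le> C * lp_norm q a" if "a \<in> lp_space q" for a
    by (rule LIMSEQ_le[OF tendsto_norm[OF lim[OF that]] tendsto_mult[OF tendsto_const limn[OF that]]])
       (use upper in auto)
  have T_diff: "T (\<lambda>i. u i - v i) = T u - T v" if "u \<in> lp_space q" "v \<in> lp_space q" for u v
    unfolding T_def using summ[OF that(1)] summ[OF that(2)]
    by (simp add: scaleR_diff_left suminf_diff)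
  have "T ` lp_space q = closure (span (range y))"
  proof (intro equalityI subsetI)
    fix z assume "z \<in> T ` lp_space q"
    then obtain a where a: "a \<in> lp_space q" "z = T a" by blast
    then have "(\<lambda>N. \<Sum>n<N. a n *\<^sub>R y n) \<longlonglongrightarrow> z" using lim by blast
    moreover have "(\<Sum>n<N. a n *\<^sub>R y n) \<in> span (range y)" for N
      by (intro span_sum span_scale span_base) auto
    ultimately show "z \<in> closure (span (range y))"
      unfolding closure_sequential
      by (intro exI[of _ "\<lambda>N. \<Sum>n<N. a n *\<^sub>R y n"] conjI allI)
  next
    fix z assume "z \<in> closure (span (range y))"
    then obtain zs where zs: "\<And>k. zs k \<in> span (range y)" "zs \<longlonglongrightarrow> z"
      unfolding closure_sequential by blast
    have "subspace (T ` lp_space q)"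
      unfolding subspace_def
    proof (intro conjI ballI allI)
      have "T (\<lambda>_. 0) = 0" by (simp add: T_def)
      moreover have "T (\<lambda>_. 0) \<in> T ` lp_space q" by (rule imageI) (simp add: lp_space_def)
      ultimately show "0 \<in> T ` lp_space q" by simp
    next
      fix u v assume "u \<in> T ` lp_space q" "v \<in> T ` lp_space q"
      then obtain a b where ab: "a \<in> lp_space q" "b \<in> lp_space q" "u = T a" "v = T b" by blast
      have "u + v = T (\<lambda>i. a i + b i)"
        using ab lin[unfolded seq_linear_on_def, THEN conjunct1, rule_format, of a b] by simp
      then show "u + v \<in> T ` lp_space q"
        by (rule rev_image_eqI[OF lp_add(1)[OF ab(1,2) q]])
    next
      fix r u assume "u \<in> T ` lp_space q"
      then obtain a where a: "a \<in> lp_space q" "u = T a" by blast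
      have "r *\<^sub>R u = T (\<lambda>i. r * a i)"
        using a lin[unfolded seq_linear_on_def, THEN conjunct2, rule_format, of a r] by simp
      then show "r *\<^sub>R u \<in> T ` lp_space q"
        by (rule rev_image_eqI[OF lp_scale(1)[OF a(1) q0]])
    qed
    moreover have "range y \<subseteq> T ` lp_space q"
    proof clarify
      fix n
      define e where "e = (\<lambda>i::nat. if i = n then 1 else 0 :: real)"
      have "e \<in> lp_space q" by (rule finite_support_lp_space) (simp add: e_def)
      moreover have "T e = (\<Sum>i\<in>{n}. e i *\<^sub>R y i)"
        unfolding T_def by (rule suminf_finite) (auto simp: e_def)
      then have "y n = T e" by (simp add: e_def)
      ultimately show "y n \<in> T ` lp_space q" by (intro rev_image_eqI)
    qed
    ultimately have "span (range y) \<subseteq> T ` lp_space q" by (rule span_minimal[rotated])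
    then have "\<exists>a. a \<in> lp_space q \<and> zs k = T a" for k using zs(1) by blast
    then obtain a where a: "\<And>k. a k \<in> lp_space q" and za: "\<And>k. zs k = T (a k)" by metis
    have bnd: "c * lp_norm q (\<lambda>i. a k i - a l i) \<le> norm (zs k - zs l)" for k l
      using low[OF lp_diff[OF a a q]] T_diff[OF a a] za by simp
    have cauchy: "\<exists>K. \<forall>k\<ge>K. \<forall>l\<ge>K. lp_norm q (\<lambda>i. a k i - a l i) < e" if e: "e > 0" for e
    proof -
      have "Cauchy zs" using zs(2) by (rule LIMSEQ_imp_Cauchy)
      then obtain K where K: "\<And>k l. k \<ge> K \<Longrightarrow> l \<ge> K \<Longrightarrow> norm (zs k - zs l) < c * e"
        unfolding Cauchy_iff using mult_pos_pos[OF c e] by metis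
      have "lp_norm q (\<lambda>i. a k i - a l i) < e" if "k \<ge> K" "l \<ge> K" for k l
      proof -
        have "c * lp_norm q (\<lambda>i. a k i - a l i) < c * e"
          using bnd[of k l] K[OF that] by linarith
        then show ?thesis using c by simp
      qed
      then show ?thesis by blast
    qed
    have "Cauchy (\<lambda>k. a k i)" for i
    proof (rule metric_CauchyI)
      fix e :: real assume "e > 0"
      then obtain K where K: "\<forall>k\<ge>K. \<forall>l\<ge>K. lp_norm q (\<lambda>i. a k i - a l i) < e"
        using cauchy by blast
      have "dist (a k i) (a l i) < e" if "k \<ge> K" "l \<ge> K" for k l
      proof -
        have "\<bar>a k i - a l i\<bar> \<le> lp_norm q (\<lambda>i. a k i - a l i)"
          by (rule abs_le_lp_norm[OF lp_diff[OF a a q] q0])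
        also have "\<dots> < e" using K that by blast
        finally show ?thesis by (simp add: dist_real_def)
      qed
      then show "\<exists>M. \<forall>m\<ge>M. \<forall>n\<ge>M. dist (a m i) (a n i) < e" by blast
    qed
    then have "\<exists>b. (\<lambda>k. a k i) \<longlonglongrightarrow> b" for i
      by (simp add: Cauchy_convergent convergentD)
    then obtain b where b: "\<And>i. (\<lambda>k. a k i) \<longlonglongrightarrow> b i" by metis
    have close: "\<exists>K. \<forall>k\<ge>K. (\<lambda>i. a k i - b i) \<in> lp_space q \<and> lp_norm q (\<lambda>i. a k i - b i) \<le> e"
      if e: "e > 0" for e
    proof -
      obtain K where K: "\<forall>k\<ge>K. \<forall>l\<ge>K. lp_norm q (\<lambda>i. a k i - a l i) < e"
        using cauchy e by blast
      \<comment> \<open>Only coordinatewise convergence is known. With \<open>N\<close> fixed,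
        \<open>l\<close> may tend to infinity in the finite sum, and the resulting bound does not
        depend on \<open>N\<close>.\<close>
      have "(\<Sum>i<N. \<bar>a k i - b i\<bar> powr q) \<le> e powr q" if k: "k \<ge> K" for k N
      proof (rule LIMSEQ_le_const2)
        show "(\<lambda>l. \<Sum>i<N. \<bar>a k i - a l i\<bar> powr q) \<longlonglongrightarrow> (\<Sum>i<N. \<bar>a k i - b i\<bar> powr q)"
          using q0 by (intro tendsto_sum tendsto_powr' tendsto_rabs tendsto_diff b tendsto_const) auto
        have "(\<Sum>i<N. \<bar>a k i - a l i\<bar> powr q) \<le> e powr q" if l: "l \<ge> K" for l
        proof -
          have "(\<Sum>i<N. \<bar>a k i - a l i\<bar> powr q) \<le> lp_norm q (\<lambda>i. a k i - a l i) powr q"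
            by (intro sum_le_lp_norm_powr lp_diff a q q0) auto
          also have "\<dots> \<le> e powr q" using K k l q0 less_imp_le by (intro powr_mono2) auto
          finally show ?thesis .
        qed
        then show "\<exists>L. \<forall>l\<ge>L. (\<Sum>i<N. \<bar>a k i - a l i\<bar> powr q) \<le> e powr q" by blast
      qed
      then show ?thesis using lp_norm_leI[OF q0, of e] e by (meson less_imp_le)
    qed
    obtain k where k: "(\<lambda>i. a k i - b i) \<in> lp_space q" using close[of 1] by auto
    have bq: "b \<in> lp_space q" using lp_diff[OF a k q, of k] by simp
    have "zs \<longlonglongrightarrow> T b"
    proof (rule LIMSEQ_I)
      fix r :: real assume r: "r > 0"
      define e where "e = r / (C + 1)"
      have "e > 0" using r C by (simp add: e_def)
      then obtain K where K: "\<forall>k\<ge>K. lp_norm q (\<lambda>i. a k i - b i) \<le> e"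
        using close by blast
      have "norm (zs k - T b) < r" if "k \<ge> K" for k
      proof -
        have "norm (zs k - T b) \<le> C * lp_norm q (\<lambda>i. a k i - b i)"
          using up[OF lp_diff[OF a bq q]] T_diff[OF a bq] za by simp
        also have "\<dots> \<le> C * e" using K that C by (intro mult_left_mono) auto
        also have "\<dots> < r" using r C by (simp add: e_def field_simps)
        finally show ?thesis .
      qed
      then show "\<exists>no. \<forall>n\<ge>no. norm (zs n - T b) < r" by blast
    qed
    then have "z = T b" using zs(2) LIMSEQ_unique by blast
    then show "z \<in> T ` lp_space q" using bq by blast
  qed
  with isomorphic_to_lpI[OF q lin c low up] show ?thesis by simp
qed

section \<open>Bounded bilinear forms\<close>

lemma subspace_closure:
  fixes S :: "'a::real_normed_vector set"
  assumes S: "subspace S"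
  shows "subspace (closure S)"
  unfolding subspace_def
proof (intro conjI ballI allI)
  show "0 \<in> closure S" using subspace_0[OF S] closure_subset by blast
next
  fix x y assume "x \<in> closure S" "y \<in> closure S"
  then obtain f g where f: "\<And>n. f n \<in> S" "f \<longlonglongrightarrow> x" and g: "\<And>n. g n \<in> S" "g \<longlonglongrightarrow> y"
    unfolding closure_sequential by blast
  show "x + y \<in> closure S"
    unfolding closure_sequential using f g subspace_add[OF S]
    by (intro exI[of _ "\<lambda>n. f n + g n"]) (simp add: tendsto_add)
next
  fix c and x assume "x \<in> closure S"
  then obtain f where f: "\<And>n. f n \<in> S" "f \<longlonglongrightarrow> x"
    unfolding closure_sequential by blast
  show "c *\<^sub>R x \<in> closure S"
    unfolding closure_sequential using f subspace_scale[OF S]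
    by (intro exI[of _ "\<lambda>n. c *\<^sub>R f n"]) (simp add: tendsto_scaleR)
qed

text \<open>The form may be degenerate: in the application it ignores everything outside
  \<open>F\<close>. All hypotheses are relative to \<open>X\<close> because the ambient space may be
  larger.\<close>

locale bounded_form =
  fixes X :: "'a::banach set" and B :: "'a \<Rightarrow> 'a \<Rightarrow> real" and C :: real
  assumes subspace_X: "subspace X"
    and add_left: "\<lbrakk>x \<in> X; y \<in> X; z \<in> X\<rbrakk> \<Longrightarrow> B (x + y) z = B x z + B y z"
    and scale_left: "\<lbrakk>x \<in> X; z \<in> X\<rbrakk> \<Longrightarrow> B (r *\<^sub>R x) z = r * B x z"
    and sym: "\<lbrakk>x \<in> X; y \<in> X\<rbrakk> \<Longrightarrow> B x y = B y x"
    and nonneg: "x \<in> X \<Longrightarrow> 0 \<le> B x x"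
    and bound: "\<lbrakk>x \<in> X; y \<in> X\<rbrakk> \<Longrightarrow> \<bar>B x y\<bar> \<le> C * norm x * norm y"
    and C_pos: "C > 0"
begin

lemma X_closed [simp, intro]:
  "0 \<in> X" "\<lbrakk>x \<in> X; y \<in> X\<rbrakk> \<Longrightarrow> x + y \<in> X" "\<lbrakk>x \<in> X; y \<in> X\<rbrakk> \<Longrightarrow> x - y \<in> X"
  "x \<in> X \<Longrightarrow> r *\<^sub>R x \<in> X"
  using subspace_X by (auto simp: subspace_0 subspace_add subspace_diff subspace_scale)

lemma diff_left: "\<lbrakk>x \<in> X; y \<in> X; z \<in> X\<rbrakk> \<Longrightarrow> B (x - y) z = B x z - B y z"
  using add_left[of "x - y" y z] by simp

lemma add_right: "\<lbrakk>x \<in> X; y \<in> X; z \<in> X\<rbrakk> \<Longrightarrow> B z (x + y) = B z x + B z y"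
  using add_left[of x y z] sym by simp

lemma diff_right: "\<lbrakk>x \<in> X; y \<in> X; z \<in> X\<rbrakk> \<Longrightarrow> B z (x - y) = B z x - B z y"
  using diff_left[of x y z] sym by simp

lemma scale_right: "\<lbrakk>x \<in> X; z \<in> X\<rbrakk> \<Longrightarrow> B z (r *\<^sub>R x) = r * B z x"
  using scale_left[of x z] sym by simp

lemma parallelogram:
  "\<lbrakk>x \<in> X; y \<in> X\<rbrakk> \<Longrightarrow> B (y - x) (y - x) + B (x + y) (x + y) = 2 * B x x + 2 * B y y"
  by (simp add: add_left diff_left add_right diff_right)

lemma zero_left [simp]: "z \<in> X \<Longrightarrow> B 0 z = 0"
  using scale_left[of 0 z 0] by simp

lemma zero_right [simp]: "z \<in> X \<Longrightarrow> B z 0 = 0"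
  using sym[of z 0] by simp

lemmas bilin = add_left diff_left scale_left add_right diff_right scale_right

lemma sum_in_X [simp, intro]: "(\<And>i. i \<in> I \<Longrightarrow> f i \<in> X) \<Longrightarrow> sum f I \<in> X"
  by (rule subspace_sum[OF subspace_X])

lemma sum_left:
  assumes "\<And>i. i \<in> I \<Longrightarrow> f i \<in> X" "z \<in> X"
  shows "B (sum f I) z = (\<Sum>i\<in>I. B (f i) z)"
  using assms(1) by (induction I rule: infinite_finite_induct) (simp_all add: add_left assms(2))

lemma tendsto_form:
  assumes "f \<longlonglongrightarrow> x" "g \<longlonglongrightarrow> y" "\<And>n. f n \<in> X" "\<And>n. g n \<in> X" "x \<in> X" "y \<in> X"
  shows "(\<lambda>n. B (f n) (g n)) \<longlonglongrightarrow> B x y"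
proof -
  have "(\<lambda>n. B (f n) (g n) - B x y) \<longlonglongrightarrow> 0"
  proof (rule Lim_null_comparison)
    have "norm (B (f n) (g n) - B x y)
        \<le> C * norm (f n - x) * norm (g n) + C * norm x * norm (g n - y)" for n
    proof -
      have "B (f n) (g n) - B x y = B (f n - x) (g n) + B x (g n - y)"
        using assms by (simp add: bilin)
      then show ?thesis
        using bound[of "f n - x" "g n"] bound[of x "g n - y"] assms by simp
    qed
    then show "\<forall>\<^sub>F n in sequentially. norm (B (f n) (g n) - B x y)
        \<le> C * norm (f n - x) * norm (g n) + C * norm x * norm (g n - y)" by simp
    have "(\<lambda>n. C * norm (f n - x) * norm (g n) + C * norm x * norm (g n - y))
        \<longlonglongrightarrow> C * norm (x - x) * norm y + C * norm x * norm (y - y)"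
      by (intro tendsto_intros assms)
    then show "(\<lambda>n. C * norm (f n - x) * norm (g n) + C * norm x * norm (g n - y)) \<longlonglongrightarrow> 0" by simp
  qed
  then show ?thesis by (simp add: LIM_zero_iff)
qed

end

text \<open>On \<open>Y\<close> the form is an inner product equivalent to the norm, so
  \<open>Y\<close> is a Hilbert space, even if \<open>B\<close> vanishes on some nonzero vectors of
  \<open>X\<close>.\<close>

locale coercive_form = bounded_form X B C
    for X :: "'a::banach set" and B C +
  fixes Y :: "'a set" and c :: real
  assumes subspace_Y: "subspace Y" and closed_Y: "closed Y" and Y_sub: "Y \<subseteq> X"
    and coercive: "y \<in> Y \<Longrightarrow> c * (norm y)\<^sup>2 \<le> B y y" and c_pos: "c > 0"
begin

lemma Y_in_X [simp, intro]: "y \<in> Y \<Longrightarrow> y \<in> X"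
  using Y_sub by blast

lemma Y_closed [simp, intro]:
  "0 \<in> Y" "\<lbrakk>x \<in> Y; y \<in> Y\<rbrakk> \<Longrightarrow> x + y \<in> Y" "\<lbrakk>x \<in> Y; y \<in> Y\<rbrakk> \<Longrightarrow> x - y \<in> Y"
  "x \<in> Y \<Longrightarrow> r *\<^sub>R x \<in> Y"
  using subspace_Y by (auto simp: subspace_0 subspace_add subspace_diff subspace_scale)

lemma form_eq_0_iff: "y \<in> Y \<Longrightarrow> B y y = 0 \<longleftrightarrow> y = 0"
  using coercive[of y] c_pos by (auto simp: mult_le_0_iff)

text \<open>The distance from \<open>x\<close> to \<open>Y\<close> in the seminorm of
  \<open>B\<close> is attained. Differences of members of a minimising sequence lie in
  \<open>Y\<close>, where coercivity turns the parallelogram law into a Cauchy estimate for the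
  norm.\<close>

lemma orthogonal_projection_exists:
  assumes x: "x \<in> X"
  shows "\<exists>y\<in>Y. \<forall>z\<in>Y. B (x - y) z = 0"
proof -
  define Q where "Q = (\<lambda>u. B u u)"
  define d where "d = (INF y\<in>Y. Q (x - y))"
  have bdd: "bdd_below ((\<lambda>y. Q (x - y)) ` Y)"
    by (rule bdd_belowI[of _ 0]) (use x nonneg in \<open>auto simp: Q_def\<close>)
  have d_le: "d \<le> Q (x - y)" if "y \<in> Y" for y
    unfolding d_def by (rule cINF_lower[OF bdd that])
  have "\<exists>y\<in>Y. Q (x - y) < d + 1 / Suc n" for n
  proof -
    have "d < d + 1 / Suc n" by simp
    moreover have "Y \<noteq> {}" using Y_closed(1) by blast
    ultimately show ?thesis
      using cINF_less_iff[OF _ bdd, of "d + 1 / Suc n"] unfolding d_def[symmetric] by blast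
  qed
  then obtain y where yY: "\<And>n. y n \<in> Y" and y: "\<And>n. Q (x - y n) < d + 1 / Suc n" by metis
  have close: "c * (norm (y m - y n))\<^sup>2 \<le> 2 / Suc m + 2 / Suc n" for m n
  proof -
    \<comment> \<open>The midpoint lies in \<open>Y\<close>, so \<open>d \<le> Q (x - w)\<close>,
      and the parallelogram law leaves only the excesses \<open>1 / Suc m\<close> and
      \<open>1 / Suc n\<close>.\<close>
    define w where "w = (1/2) *\<^sub>R (y m + y n)"
    have "w \<in> Y" by (simp add: w_def yY)
    have m: "x - y m \<in> X" "x - y n \<in> X" using x yY by auto
    have "(x - y m) + (x - y n) = 2 *\<^sub>R (x - w)"
      by (simp add: w_def algebra_simps flip: scaleR_2)
    then have "Q ((x - y m) + (x - y n)) = 4 * Q (x - w)"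
      unfolding Q_def using \<open>w \<in> Y\<close> x by (simp add: scale_left scale_right)
    moreover have "y m - y n = (x - y n) - (x - y m)" by simp
    then have "Q (y m - y n) + Q ((x - y m) + (x - y n)) = 2 * Q (x - y m) + 2 * Q (x - y n)"
      using parallelogram[OF m] by (simp only: Q_def)
    moreover have "c * (norm (y m - y n))\<^sup>2 \<le> Q (y m - y n)"
      unfolding Q_def using yY by (intro coercive) auto
    ultimately show ?thesis using y[of m] y[of n] d_le[OF \<open>w \<in> Y\<close>] by simp
  qed
  have "Cauchy y"
  proof (rule metric_CauchyI)
    fix e :: real assume e: "e > 0"
    obtain K :: nat where K: "4 / (c * e\<^sup>2) < Suc K"
      using reals_Archimedean2 less_trans lessI of_nat_less_iff by metis
    have "dist (y m) (y n) < e" if "m \<ge> K" "n \<ge> K" for m n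
    proof -
      have "c * (norm (y m - y n))\<^sup>2 \<le> 2 / Suc m + 2 / Suc n" by (rule close)
      also have "\<dots> \<le> 2 / Suc K + 2 / Suc K"
        using that by (intro add_mono divide_left_mono) auto
      also have "\<dots> = 4 / Suc K" by simp
      also have "\<dots> < c * e\<^sup>2"
        using K e c_pos by (simp only: pos_divide_less_eq mult.commute mult_pos_pos zero_less_power
            of_nat_0_less_iff zero_less_Suc)
      finally have "(norm (y m - y n))\<^sup>2 < e\<^sup>2" using c_pos by simp
      then show ?thesis using e by (simp add: dist_norm power_less_imp_less_base)
    qed
    then show "\<exists>M. \<forall>m\<ge>M. \<forall>n\<ge>M. dist (y m) (y n) < e" by blast
  qed
  then obtain y0 where lim: "y \<longlonglongrightarrow> y0" using Cauchy_convergent convergent_def by blast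
  then have y0: "y0 \<in> Y" using closed_Y yY closed_sequentially by blast
  define u where "u = x - y0"
  have uX: "u \<in> X" using x y0 by (auto simp: u_def)
  have "(\<lambda>n. B (x - y n) (x - y n)) \<longlonglongrightarrow> B u u"
    unfolding u_def using x yY y0 by (intro tendsto_form tendsto_intros lim) auto
  moreover have "(\<lambda>n. d + 1 / Suc n) \<longlonglongrightarrow> d + 0"
    by (intro tendsto_intros LIMSEQ_Suc[OF lim_1_over_n])
  ultimately have Qu: "Q u \<le> d"
    using y unfolding Q_def by (intro LIMSEQ_le[of "\<lambda>n. B (x - y n) (x - y n)"]) (auto intro: less_imp_le)
  have "B u z = 0" if z: "z \<in> Y" for z
  proof (cases "z = 0")
    case False
    \<comment> \<open>This \<open>t\<close> minimises \<open>Q (u - t *\<^sub>R z)\<close>; it would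
      lower \<open>Q u\<close> by \<open>(B u z)\<^sup>2 / B z z\<close>, which minimality forbids
      unless \<open>B u z = 0\<close>.\<close>
    define t where "t = B u z / B z z"
    have zz: "B z z > 0" using nonneg[of z] form_eq_0_iff[OF z] False z by fastforce
    have "d \<le> Q (x - (y0 + t *\<^sub>R z))" using y0 z by (intro d_le) auto
    also have "x - (y0 + t *\<^sub>R z) = u - t *\<^sub>R z" by (simp add: u_def)
    also have "Q \<dots> = Q u - 2 * t * B u z + t * (t * B z z)"
      unfolding Q_def using uX z sym[of u z] by (simp add: bilin algebra_simps)
    also have "\<dots> = Q u - (B u z)\<^sup>2 / B z z" using zz by (simp add: t_def power2_eq_square)
    finally have "(B u z)\<^sup>2 / B z z \<le> 0" using Qu by simp
    then show ?thesis using zz by (simp add: divide_le_0_iff)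
  qed (use uX in simp)
  then show ?thesis using y0 unfolding u_def by blast
qed

lemma complemented: "complemented_in X Y"
proof -
  have "\<exists>P. \<forall>x\<in>X. P x \<in> Y \<and> (\<forall>z\<in>Y. B (x - P x) z = 0)"
    using orthogonal_projection_exists by (intro bchoice) blast
  then obtain P where PY: "\<And>x. x \<in> X \<Longrightarrow> P x \<in> Y"
    and P: "\<And>x z. x \<in> X \<Longrightarrow> z \<in> Y \<Longrightarrow> B (x - P x) z = 0" by blast
  \<comment> \<open>Orthogonality to \<open>Y\<close> determines the value of \<open>P\<close>,
    since the form is definite on \<open>Y\<close>; linearity and \<open>P y = y\<close> on
    \<open>Y\<close> then amount to checking orthogonality.\<close>
  have uniq: "P x = y" if "x \<in> X" "y \<in> Y" "\<And>z. z \<in> Y \<Longrightarrow> B (x - y) z = 0" for x y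
  proof -
    have "P x - y \<in> Y" using PY that by auto
    moreover have "B (P x - y) (P x - y) = B (x - y) (P x - y) - B (x - P x) (P x - y)"
      using that PY by (simp add: bilin)
    ultimately have "P x - y = 0" using P that form_eq_0_iff by simp
    then show ?thesis by simp
  qed
  have fixed: "P y = y" if "y \<in> Y" for y using that by (intro uniq) auto
  have "lin_on X P"
    unfolding lin_on_def
  proof (intro conjI ballI allI)
    fix x y assume xy: "x \<in> X" "y \<in> X"
    show "P (x + y) = P x + P y"
    proof (rule uniq)
      fix z assume z: "z \<in> Y"
      have "x + y - (P x + P y) = (x - P x) + (y - P y)" by simp
      then show "B (x + y - (P x + P y)) z = 0"
        using xy z P PY by (simp only: add_left X_closed Y_in_X)
    qed (use xy PY in auto)
  next
    fix r x assume x: "x \<in> X"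
    show "P (r *\<^sub>R x) = r *\<^sub>R P x"
    proof (rule uniq)
      fix z assume z: "z \<in> Y"
      then show "B (r *\<^sub>R x - r *\<^sub>R P x) z = 0"
        using x z P PY by (simp add: scale_left flip: scaleR_diff_right)
    qed (use x PY in auto)
  qed
  moreover have "norm (P x) \<le> (C / c) * norm x" if x: "x \<in> X" for x
  proof (cases "P x = 0")
    case False
    have "c * (norm (P x))\<^sup>2 \<le> B (P x) (P x)" using PY[OF x] by (rule coercive)
    also have "\<dots> = B x (P x)" using P[OF x PY[OF x]] x PY by (simp add: bilin)
    also have "\<dots> \<le> C * norm x * norm (P x)" using bound[of x "P x"] x PY by fastforce
    finally have "norm (P x) * (c * norm (P x)) \<le> norm (P x) * (C * norm x)"
      by (simp add: power2_eq_square mult_ac)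
    then have "c * norm (P x) \<le> C * norm x" using False by simp
    then show ?thesis using c_pos by (simp add: field_simps)
  qed (use C_pos c_pos in simp)
  moreover have "P ` X = Y" using PY fixed by force
  ultimately show ?thesis
    unfolding complemented_in_def using Y_sub PY fixed by blast
qed

end

text \<open>Vectors that are dependent on their predecessors become 0; for those the quotient is 0/0 = 0.\<close>

function gram_schmidt ::
  "('a::real_vector \<Rightarrow> 'a \<Rightarrow> real) \<Rightarrow> (nat \<Rightarrow> 'a) \<Rightarrow> nat \<Rightarrow> 'a" where
  "gram_schmidt B v n = v n - (\<Sum>i<n. (B (v n) (gram_schmidt B v i) /
     B (gram_schmidt B v i) (gram_schmidt B v i)) *\<^sub>R gram_schmidt B v i)"
  by auto
termination by (relation "Wellfounded.measure (\<lambda>(B, v, n). n)") auto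

declare gram_schmidt.simps [simp del]

section \<open>Orthonormal bases and the isomorphism with l_2\<close>

context coercive_form
begin

text \<open>The sequence \<open>v\<close> is orthogonalised with respect to \<open>B\<close> and the
  vanishing vectors are dropped. Infinite dimension leaves infinitely many, so the normalised ones
  can be indexed by all natural numbers.\<close>

lemma isomorphic_to_l2:
  fixes v :: "nat \<Rightarrow> 'a"
  assumes vY: "\<And>n. v n \<in> Y" and dense: "Y \<subseteq> closure (span (range v))"
    and inf: "infinite_dimensional Y"
  shows "isomorphic_to_lp 2 Y"
proof -
  define u where "u = gram_schmidt B v"
  have u_eq: "u n = v n - (\<Sum>i<n. (B (v n) (u i) / B (u i) (u i)) *\<^sub>R u i)" for n
    unfolding u_def by (rule gram_schmidt.simps)
  have uY: "u n \<in> Y" for n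
  proof (induction n rule: less_induct)
    case (less n)
    then show ?case
      by (subst u_eq) (intro Y_closed vY subspace_sum[OF subspace_Y], auto)
  qed
  have orth_less: "m < n \<Longrightarrow> B (u n) (u m) = 0" for m n
  proof (induction n arbitrary: m rule: less_induct)
    case (less n)
    have off: "B (u i) (u m) = 0" if "i < n" "i \<noteq> m" for i
    proof (cases "m < i")
      case True
      then show ?thesis using less.IH[OF \<open>i < n\<close>] by simp
    next
      case False
      then show ?thesis using less.IH[OF less.prems, of i] that sym[of "u i" "u m"] uY by simp
    qed
    have "B (u n) (u m) = B (v n) (u m)
        - (\<Sum>i<n. B ((B (v n) (u i) / B (u i) (u i)) *\<^sub>R u i) (u m))"
      by (subst u_eq, subst diff_left, use uY vY in \<open>auto simp: sum_left\<close>)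
    also have "(\<Sum>i<n. B ((B (v n) (u i) / B (u i) (u i)) *\<^sub>R u i) (u m))
        = (\<Sum>i<n. B (v n) (u i) / B (u i) (u i) * B (u i) (u m))"
      using uY by (simp add: scale_left)
    also have "\<dots> = (\<Sum>i\<in>{m}. B (v n) (u i) / B (u i) (u i) * B (u i) (u m))"
      using less.prems off by (intro sum.mono_neutral_right) auto
    also have "\<dots> = B (v n) (u m)"
      using form_eq_0_iff[OF uY, of m] vY by auto
    finally show ?case by simp
  qed
  have orth: "B (u m) (u n) = 0" if "m \<noteq> n" for m n
    using that orth_less[of m n] orth_less[of n m] sym[of "u m" "u n"] uY
    by (cases m n rule: linorder_cases) auto
  have "v n \<in> span (range u)" for n
  proof -
    have "v n = u n + (\<Sum>i<n. (B (v n) (u i) / B (u i) (u i)) *\<^sub>R u i)" using u_eq[of n] by simp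
    also have "\<dots> \<in> span (range u)" by (intro span_add span_sum span_scale span_base) auto
    finally show ?thesis .
  qed
  then have "span (range v) \<subseteq> span (range u)" by (intro span_minimal) auto
  then have dense_u: "Y \<subseteq> closure (span (range u))" using dense closure_mono by blast
  \<comment> \<open>Totality of the \<open>u n\<close>: by continuity of the form, orthogonality
    extends to the closure of their span, which contains \<open>y\<close> itself.\<close>
  have orth_dense: "y = 0" if y: "y \<in> Y" and "\<And>n. B y (u n) = 0" for y
  proof -
    have span0: "z \<in> Y \<and> B y z = 0" if "z \<in> span (range u)" for z
      using that
    proof (induction rule: span_induct_alt)
      case base
      then show ?case using y by simp
    next
      case (step r w z)
      then show ?case using y uY \<open>\<And>n. B y (u n) = 0\<close> by (auto simp: add_right scale_right)
    qed
    have "y \<in> closure (span (range u))" using dense_u y by blast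
    then obtain f where f: "\<And>n. f n \<in> span (range u)" "f \<longlonglongrightarrow> y"
      unfolding closure_sequential by blast
    have "(\<lambda>n. B y (f n)) \<longlonglongrightarrow> B y y"
      using y f span0 by (intro tendsto_form tendsto_const) auto
    then have "B y y = 0" using span0 f(1) by (simp add: LIMSEQ_const_iff)
    then show ?thesis using y form_eq_0_iff by blast
  qed
  define I where "I = {n. u n \<noteq> 0}"
  have "infinite I"
  proof
    assume fin: "finite I"
    have "Y \<subseteq> span (u ` I)"
    proof
      fix y assume y: "y \<in> Y"
      \<comment> \<open>The Fourier sum of \<open>y\<close>, finite under the assumption on
        \<open>I\<close>; the remainder is orthogonal to every \<open>u n\<close> and hence
        0.\<close>
      define s where "s = (\<Sum>i\<in>I. (B y (u i) / B (u i) (u i)) *\<^sub>R u i)"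
      have sY: "s \<in> Y" unfolding s_def by (intro subspace_sum[OF subspace_Y] Y_closed uY)
      have "B (y - s) (u n) = 0" for n
      proof (cases "n \<in> I")
        case True
        have "B s (u n) = (\<Sum>i\<in>I. B y (u i) / B (u i) (u i) * B (u i) (u n))"
          unfolding s_def using uY by (subst sum_left) (auto simp: scale_left)
        also have "\<dots> = (\<Sum>i\<in>{n}. B y (u i) / B (u i) (u i) * B (u i) (u n))"
          using True fin orth by (intro sum.mono_neutral_right) auto
        also have "\<dots> = B y (u n)" using form_eq_0_iff[OF uY, of n] True by (simp add: I_def)
        finally show ?thesis using y sY uY by (simp add: diff_left)
      next
        case False
        then show ?thesis using y sY by (simp add: I_def)
      qed
      then have "y - s = 0" using y sY by (intro orth_dense) auto
      then have "y = s" by simp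
      also have "\<dots> \<in> span (u ` I)" unfolding s_def by (intro span_sum span_scale span_base) auto
      finally show "y \<in> span (u ` I)" .
    qed
    then show False using inf fin unfolding infinite_dimensional_def by blast
  qed
  define r where "r = enumerate I"
  have rI: "r n \<in> I" for n using enumerate_in_set[OF \<open>infinite I\<close>] by (simp add: r_def)
  have r_inj: "r m = r n \<longleftrightarrow> m = n" for m n
    using strict_mono_enumerate[OF \<open>infinite I\<close>] by (simp add: r_def strict_mono_eq)
  have r_range: "range r = I" using range_enumerate[OF \<open>infinite I\<close>] by (simp add: r_def)
  define e where "e = (\<lambda>n. (1 / sqrt (B (u (r n)) (u (r n)))) *\<^sub>R u (r n))"
  have eY: "e n \<in> Y" for n using uY by (simp add: e_def)
  have pos: "B (u (r n)) (u (r n)) > 0" for n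
    using nonneg[of "u (r n)"] form_eq_0_iff[OF uY, of "r n"] uY rI[of n] by (force simp: I_def)
  have ortho: "B (e m) (e n) = (if m = n then 1 else 0)" for m n
    using pos[of n] uY r_inj[of m n] orth[of "r m" "r n"]
    by (auto simp: e_def scale_left scale_right)
  have "closure (span (range e)) = Y"
  proof
    show "closure (span (range e)) \<subseteq> Y"
      using eY by (intro closure_minimal span_minimal subspace_Y closed_Y) auto
    have "u n \<in> span (range e)" for n
    proof (cases "n \<in> I")
      case True
      then obtain m where m: "n = r m" using r_range by blast
      have "u n = sqrt (B (u n) (u n)) *\<^sub>R e m" using pos[of m] by (simp add: e_def m)
      then show ?thesis by (metis rangeI span_base span_scale)
    qed (simp add: I_def span_zero)
    then have "span (range u) \<subseteq> span (range e)" by (intro span_minimal) auto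
    then show "Y \<subseteq> closure (span (range e))" using dense_u closure_mono by blast
  qed
  moreover have form_e: "B (\<Sum>n<N. a n *\<^sub>R e n) (\<Sum>n<N. a n *\<^sub>R e n) = (\<Sum>n<N. (a n)\<^sup>2)"
    and sumY: "(\<Sum>n<N. a n *\<^sub>R e n) \<in> Y" for a N
  proof -
    show "(\<Sum>n<N. a n *\<^sub>R e n) \<in> Y" by (intro subspace_sum[OF subspace_Y] Y_closed eY)
    show "B (\<Sum>n<N. a n *\<^sub>R e n) (\<Sum>n<N. a n *\<^sub>R e n) = (\<Sum>n<N. (a n)\<^sup>2)"
    proof (induction N)
      case (Suc N)
      define w where "w = (\<Sum>n<N. a n *\<^sub>R e n)"
      have w: "w \<in> Y" unfolding w_def by (intro subspace_sum[OF subspace_Y] Y_closed eY)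
      have "B w (e N) = 0"
        unfolding w_def using eY by (subst sum_left) (auto simp: scale_left ortho)
      then show ?case
        using Suc w eY sym[of w "e N"] ortho[of N N]
        by (simp add: bilin power2_eq_square flip: w_def)
    qed simp
  qed
  \<comment> \<open>The constants come from
    \<open>c * (norm w)\<^sup>2 \<le> B w w \<le> C * (norm w)\<^sup>2\<close>, where
    \<open>B w w\<close> is the sum of the squared coefficients.\<close>
  have "isomorphic_to_lp 2 (closure (span (range e)))"
  proof (rule isomorphic_to_lp_closure_span[of 2 "1 / sqrt C" "1 / sqrt c"])
    fix a :: "nat \<Rightarrow> real" and N
    define w where "w = (\<Sum>n<N. a n *\<^sub>R e n)"
    have *: "(\<Sum>n<N. \<bar>a n\<bar> powr 2) powr (1 / 2) = sqrt (B w w)"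
      by (simp add: w_def form_e powr_half_sqrt sum_nonneg)
    have wY: "w \<in> Y" by (simp add: w_def sumY)
    have "sqrt (B w w) \<le> sqrt (C * (norm w)\<^sup>2)"
      using bound[of w w] wY by (intro real_sqrt_le_mono) (auto simp: power2_eq_square)
    then show "1 / sqrt C * (\<Sum>n<N. \<bar>a n\<bar> powr 2) powr (1 / 2) \<le> norm (\<Sum>n<N. a n *\<^sub>R e n)"
      unfolding * w_def[symmetric] using C_pos by (simp add: real_sqrt_mult field_simps)
    have "sqrt (c * (norm w)\<^sup>2) \<le> sqrt (B w w)"
      using coercive[OF wY] by (rule real_sqrt_le_mono)
    then show "norm (\<Sum>n<N. a n *\<^sub>R e n) \<le> 1 / sqrt c * (\<Sum>n<N. \<bar>a n\<bar> powr 2) powr (1 / 2)"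
      unfolding * w_def[symmetric] using c_pos by (simp add: real_sqrt_mult field_simps)
  qed (use C_pos c_pos in auto)
  ultimately show ?thesis by simp
qed

end

section \<open>The tree norm\<close>

definition mask :: "nat set \<Rightarrow> (nat \<Rightarrow> real) \<Rightarrow> nat \<Rightarrow> real" where
  "mask A x = (\<lambda>i. if i \<in> A then x i else 0)"

text \<open>The sum runs over the support only, so that \<open>F\<close> may be infinite: a sum over
  an infinite set would be 0 by convention.\<close>

definition sq :: "nat set \<Rightarrow> (nat \<Rightarrow> real) \<Rightarrow> real" where
  "sq F x = (\<Sum>i | i \<in> F \<and> x i \<noteq> 0. (x i)\<^sup>2)"

lemma c00D: "x \<in> c00 \<Longrightarrow> finite {i. x i \<noteq> 0}"
  by (simp add: c00_def)

lemma c00_mono: "y \<in> c00 \<Longrightarrow> (\<And>i. y i = 0 \<Longrightarrow> x i = 0) \<Longrightarrow> x \<in> c00"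
  unfolding c00_def mem_Collect_eq by (erule finite_subset[rotated]) blast

lemma c00_add: "x \<in> c00 \<Longrightarrow> y \<in> c00 \<Longrightarrow> (\<lambda>i. x i + y i) \<in> c00"
  unfolding c00_def mem_Collect_eq
  by (rule finite_subset[of _ "{i. x i \<noteq> 0} \<union> {i. y i \<noteq> 0}"]) auto

lemma c00_scale: "x \<in> c00 \<Longrightarrow> (\<lambda>i. c * x i) \<in> c00"
  by (erule c00_mono) simp

lemma c00_diff: "x \<in> c00 \<Longrightarrow> y \<in> c00 \<Longrightarrow> (\<lambda>i. x i - y i) \<in> c00"
  using c00_add[of x "\<lambda>i. - 1 * y i"] c00_scale[of y "- 1"] by simp

lemma c00_mask: "x \<in> c00 \<Longrightarrow> mask A x \<in> c00"
  by (erule c00_mono) (simp add: mask_def)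

lemma c00_zero: "(\<lambda>_. 0) \<in> c00"
  by (simp add: c00_def)

lemma c00_sum:
  assumes "finite I" "\<And>n. n \<in> I \<Longrightarrow> x n \<in> c00"
  shows "(\<lambda>i. \<Sum>n\<in>I. x n i) \<in> c00"
  using assms by (induction I rule: finite_induct) (simp_all add: c00_zero c00_add)

lemma sq_eq_sum:
  assumes "finite G" "\<And>i. i \<in> F \<Longrightarrow> x i \<noteq> 0 \<Longrightarrow> i \<in> G" "G \<subseteq> F"
  shows "sq F x = (\<Sum>i\<in>G. (x i)\<^sup>2)"
  unfolding sq_def using assms by (intro sum.mono_neutral_left) auto

lemma sq_nonneg: "0 \<le> sq F x"
  by (simp add: sq_def sum_nonneg)

lemma sq_mono:
  assumes "x \<in> c00" "F \<subseteq> G"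
  shows "sq F x \<le> sq G x"
  unfolding sq_def using assms c00D[OF assms(1)] by (intro sum_mono2) auto

lemma sum_le_sq:
  assumes "x \<in> c00" "\<And>i. i \<in> s \<Longrightarrow> x i \<noteq> 0 \<Longrightarrow> i \<in> F" "finite s"
  shows "(\<Sum>i\<in>s. (x i)\<^sup>2) \<le> sq F x"
proof -
  have "(\<Sum>i\<in>s. (x i)\<^sup>2) = (\<Sum>i\<in>{i \<in> s. x i \<noteq> 0}. (x i)\<^sup>2)"
    using assms by (intro sum.mono_neutral_right) auto
  also have "\<dots> \<le> sq F x"
    unfolding sq_def using assms c00D[OF assms(1)] by (intro sum_mono2) auto
  finally show ?thesis .
qed

lemma sq_Un_le:
  assumes "x \<in> c00"
  shows "sq (F \<union> G) x \<le> sq F x + sq G x"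
proof -
  have fin: "finite {i. i \<in> F \<and> x i \<noteq> 0}" "finite {i. i \<in> G \<and> x i \<noteq> 0}"
    by (rule finite_subset[OF _ c00D[OF assms]]; blast)+
  have "{i. i \<in> F \<union> G \<and> x i \<noteq> 0} = {i. i \<in> F \<and> x i \<noteq> 0} \<union> {i. i \<in> G \<and> x i \<noteq> 0}" by auto
  then show ?thesis
    unfolding sq_def using fin by (simp add: sum.union_inter sum_Un sum_nonneg)
qed

lemma sum_mask_sq:
  "finite t \<Longrightarrow> (\<Sum>i\<in>t. (mask A x i)\<^sup>2) = (\<Sum>i\<in>t \<inter> A. (x i)\<^sup>2)"
  by (subst sum.inter_restrict) (auto simp: mask_def intro!: sum.cong)

lemma sum_UN_le:
  fixes f :: "'b \<Rightarrow> real"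
  assumes "finite I" "\<And>i. i \<in> I \<Longrightarrow> finite (A i)" "\<And>x. 0 \<le> f x"
  shows "sum f (\<Union>i\<in>I. A i) \<le> (\<Sum>i\<in>I. sum f (A i))"
  using assms(1,2)
proof (induction I rule: finite_induct)
  case (insert i I)
  then have "sum f (A i \<union> (\<Union>i\<in>I. A i)) \<le> sum f (A i) + sum f (\<Union>i\<in>I. A i)"
    by (subst sum_Un) (auto intro: sum_nonneg assms(3))
  also have "\<dots> \<le> sum f (A i) + (\<Sum>i\<in>I. sum f (A i))" using insert by simp
  finally show ?case using insert by simp
qed simp

lemma powr_le_imp_le:
  assumes "u powr r \<le> v powr r" "r > 0" "0 \<le> u" "0 \<le> v"
  shows "u \<le> (v::real)"
  using assms powr_less_mono2[of r v u] by force

section \<open>Segments, tree-convex sets and the norm\<close>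

locale jt_tree =
  fixes le :: "nat \<Rightarrow> nat \<Rightarrow> bool" and p :: real
  assumes tree: "tree_order le" and p_gt_2: "2 < p"
begin

abbreviation nrm :: "(nat \<Rightarrow> real) \<Rightarrow> real" where
  "nrm \<equiv> jt_norm le p"

lemma le_refl [simp, intro]: "le i i"
  using tree unfolding tree_order_def by (simp add: reflpD)

lemma le_trans: "le i j \<Longrightarrow> le j k \<Longrightarrow> le i k"
  using tree unfolding tree_order_def by (meson transpD)

lemma le_imp_leq: "le i j \<Longrightarrow> i \<le> j"
  using tree unfolding tree_order_def by blast

lemma le_chain: "le i k \<Longrightarrow> le j k \<Longrightarrow> i \<le> j \<Longrightarrow> le i j"
proof -
  assume *: "le i k" "le j k" "i \<le> j"
  have "\<forall>n k l. le k n \<and> le l n \<longrightarrow> le k l \<or> le l k" using tree unfolding tree_order_def by blast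
  then have "le i j \<or> le j i" using * by blast
  then show "le i j" using le_imp_leq[of j i] * by auto
qed

text \<open>These sets meet a segment in a segment or not at all. Two kinds are used: intervals of
  natural numbers and subtrees above a node.\<close>

definition tree_convex :: "nat set \<Rightarrow> bool" where
  "tree_convex A \<longleftrightarrow> (\<forall>m\<in>A. \<forall>n\<in>A. \<forall>k. le m k \<and> le k n \<longrightarrow> k \<in> A)"

text \<open>Sets of segments replace the indexed families in the norm. Nothing is lost, because
  disjoint nonempty segments are distinct, and the empty family becomes available with sum
  0.\<close>

definition seg_family :: "nat set set \<Rightarrow> bool" where
  "seg_family S \<longleftrightarrow> finite S \<and> (\<forall>s\<in>S. segment le s) \<and> pairwise disjnt S"

definition seg_sum :: "nat set set \<Rightarrow> (nat \<Rightarrow> real) \<Rightarrow> real" where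
  "seg_sum S x = (\<Sum>s\<in>S. (\<Sum>i\<in>s. (x i)\<^sup>2) powr (p / 2))"

lemma finite_segment: "segment le s \<Longrightarrow> finite s"
proof -
  assume "segment le s"
  then obtain m n where "s = {k. le m k \<and> le k n}" unfolding segment_def by blast
  then have "s \<subseteq> {..n}" using le_imp_leq by auto
  then show ?thesis using finite_subset by blast
qed

lemma segment_nonempty: "segment le s \<Longrightarrow> s \<noteq> {}"
  unfolding segment_def by blast

lemma segment_chain: "segment le s \<Longrightarrow> i \<in> s \<Longrightarrow> j \<in> s \<Longrightarrow> i \<le> j \<Longrightarrow> le i j"
  unfolding segment_def using le_chain by blast

text \<open>A segment is a chain on which the tree order and the usual order agree, so the least and
  the greatest element of the intersection are its end points; convexity fills the space between
  them.\<close>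

lemma segment_Int:
  assumes s: "segment le s" and A: "tree_convex A" and ne: "s \<inter> A \<noteq> {}"
  shows "segment le (s \<inter> A)"
proof -
  obtain a b where ab: "s = {k. le a k \<and> le k b}" using s unfolding segment_def by blast
  define m n where "m = Min (s \<inter> A)" and "n = Max (s \<inter> A)"
  have fin: "finite (s \<inter> A)" using finite_segment[OF s] by blast
  have m: "m \<in> s \<inter> A" unfolding m_def by (rule Min_in[OF fin ne])
  have n: "n \<in> s \<inter> A" unfolding n_def by (rule Max_in[OF fin ne])
  have bounds: "m \<le> k" "k \<le> n" if "k \<in> s \<inter> A" for k
    unfolding m_def n_def using fin that by (rule Min_le Max_ge)+
  have "s \<inter> A = {k. le m k \<and> le k n}"
  proof (intro equalityI subsetI)
    fix k assume k: "k \<in> s \<inter> A"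
    then show "k \<in> {k. le m k \<and> le k n}" using segment_chain[OF s] bounds[OF k] m n by blast
  next
    fix k assume k: "k \<in> {k. le m k \<and> le k n}"
    then have "k \<in> A" using A m n unfolding tree_convex_def by blast
    moreover have "le a m" "le n b" using m n ab by auto
    then have "k \<in> s" using k le_trans[of a m k] le_trans[of k n b] unfolding ab by blast
    ultimately show "k \<in> s \<inter> A" by blast
  qed
  moreover have "le m n"
    using segment_chain[OF s] m n bounds(1)[OF n] by blast
  ultimately show ?thesis unfolding segment_def by blast
qed

text \<open>The predecessors of \<open>t\<close> form a chain, so the numerically least of them lies
  below all others and serves as the lower end.\<close>

lemma segment_down: "segment le {k. le k t}"
proof -
  define m where "m = (LEAST k. le k t)"
  have m: "le m t" unfolding m_def by (rule LeastI[of _ t]) simp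
  have "le m k" if "le k t" for k
    using le_chain[OF m that] Least_le[of "\<lambda>k. le k t", OF that] by (simp add: m_def)
  then have "{k. le k t} = {k. le m k \<and> le k t}" by blast
  then show ?thesis unfolding segment_def using m by blast
qed

lemma seg_family_empty [simp]: "seg_family {}"
  by (simp add: seg_family_def)

lemma seg_sum_empty [simp]: "seg_sum {} x = 0"
  by (simp add: seg_sum_def)

lemma norm_nonneg: "x \<in> c00 \<Longrightarrow> 0 \<le> nrm x"
proof -
  assume x: "x \<in> c00"
  obtain v where v: "v \<in> jt_sums le p x" using jt_sums_nonempty[OF tree] by blast
  then have "0 \<le> v" unfolding jt_sums_def by force
  also have "v \<le> nrm x"
    unfolding jt_norm_def using v jt_sums_bdd_above[OF tree _ x, of p] p_gt_2 by (intro cSup_upper) auto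
  finally show ?thesis .
qed

lemma seg_sum_le_norm:
  assumes x: "x \<in> c00" and S: "seg_family S"
  shows "seg_sum S x \<le> nrm x powr p"
proof (cases "S = {}")
  case False
  have fin: "finite S" and seg: "\<And>s. s \<in> S \<Longrightarrow> segment le s" and disj: "pairwise disjnt S"
    using S by (auto simp: seg_family_def)
  obtain h where h: "bij_betw h {1..card S} S" using ex_bij_betw_nat_finite_1[OF fin] by blast
  have "disjoint_family_on h {1..card S}"
    unfolding disjoint_family_on_def
  proof (intro ballI impI)
    fix k l assume kl: "k \<in> {1..card S}" "l \<in> {1..card S}" "k \<noteq> l"
    then have "h k \<noteq> h l" "h k \<in> S" "h l \<in> S"
      using h by (auto simp: bij_betw_def inj_on_eq_iff)
    then show "h k \<inter> h l = {}" using disj by (auto simp: pairwise_def disjnt_def)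
  qed
  moreover have "\<forall>k\<in>{1..card S}. segment le (h k)" using h seg by (auto simp: bij_betw_def)
  moreover have "card S \<ge> 1" using False fin by (simp add: Suc_le_eq card_gt_0_iff)
  ultimately have "(\<Sum>k=1..card S. (\<Sum>i\<in>h k. (x i)\<^sup>2) powr (p / 2)) powr (1 / p) \<in> jt_sums le p x"
    unfolding jt_sums_def by blast
  also have "(\<Sum>k=1..card S. (\<Sum>i\<in>h k. (x i)\<^sup>2) powr (p / 2)) = seg_sum S x"
    unfolding seg_sum_def by (rule sum.reindex_bij_betw[OF h])
  finally have "seg_sum S x powr (1 / p) \<le> nrm x"
    unfolding jt_norm_def using jt_sums_bdd_above[OF tree _ x, of p] p_gt_2 by (intro cSup_upper) auto
  then have "(seg_sum S x powr (1 / p)) powr p \<le> nrm x powr p"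
    using p_gt_2 by (intro powr_mono2) auto
  moreover have "0 \<le> seg_sum S x" by (simp add: seg_sum_def sum_nonneg)
  ultimately show ?thesis using p_gt_2 by (simp add: powr_powr)
qed simp

lemma norm_powr_le:
  assumes x: "x \<in> c00" and M: "\<And>S. seg_family S \<Longrightarrow> seg_sum S x \<le> M"
  shows "nrm x powr p \<le> M"
proof -
  have M0: "M \<ge> 0" using M[of "{}"] by simp
  have "nrm x \<le> M powr (1 / p)"
    unfolding jt_norm_def
  proof (rule cSup_least[OF jt_sums_nonempty[OF tree]])
    fix v assume "v \<in> jt_sums le p x"
    then obtain n :: nat and s
      where v: "v = (\<Sum>k=1..n. (\<Sum>i\<in>s k. (x i)\<^sup>2) powr (p / 2)) powr (1 / p)"
        and seg: "\<And>k. k \<in> {1..n} \<Longrightarrow> segment le (s k)" and disj: "disjoint_family_on s {1..n}"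
      unfolding jt_sums_def by blast
    have inj: "inj_on s {1..n}"
    proof (rule inj_onI, rule ccontr)
      fix k l assume kl: "k \<in> {1..n}" "l \<in> {1..n}" "s k = s l" "k \<noteq> l"
      then have "s k \<inter> s l = {}" using disj unfolding disjoint_family_on_def by blast
      then show False using segment_nonempty[OF seg[OF kl(1)]] kl by simp
    qed
    have "pairwise disjnt (s ` {1..n})"
      using disj by (intro pairwise_imageI) (auto simp: disjoint_family_on_def disjnt_def)
    then have "seg_family (s ` {1..n})" using seg by (auto simp: seg_family_def)
    then have "seg_sum (s ` {1..n}) x \<le> M" by (rule M)
    then have "(\<Sum>k=1..n. (\<Sum>i\<in>s k. (x i)\<^sup>2) powr (p / 2)) \<le> M"
      by (simp only: seg_sum_def sum.reindex[OF inj] o_def)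
    then show "v \<le> M powr (1 / p)"
      unfolding v using p_gt_2 by (intro powr_mono2) (auto intro: sum_nonneg)
  qed
  then have "nrm x powr p \<le> (M powr (1 / p)) powr p"
    using p_gt_2 norm_nonneg[OF x] by (intro powr_mono2) auto
  then show ?thesis using M0 p_gt_2 by (simp add: powr_powr)
qed

lemma norm_mono:
  assumes y: "y \<in> c00" and xy: "\<And>i. \<bar>x i\<bar> \<le> \<bar>y i\<bar>"
  shows "nrm x \<le> nrm y"
proof -
  have x: "x \<in> c00" by (rule c00_mono[OF y]) (use xy abs_le_zero_iff in \<open>metis abs_zero\<close>)
  have "nrm x powr p \<le> nrm y powr p"
  proof (rule norm_powr_le[OF x])
    fix S assume S: "seg_family S"
    have "seg_sum S x \<le> seg_sum S y"
      unfolding seg_sum_def using xy p_gt_2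
      by (intro sum_mono powr_mono2 sum_nonneg) (auto intro: abs_le_square_iff[THEN iffD1])
    then show "seg_sum S x \<le> nrm y powr p" using seg_sum_le_norm[OF y S] by linarith
  qed
  then show ?thesis using powr_le_imp_le p_gt_2 norm_nonneg x y by simp
qed

lemma norm_mask_le: "x \<in> c00 \<Longrightarrow> nrm (mask A x) \<le> nrm x"
  by (rule norm_mono) (auto simp: mask_def)

lemma segment_sq_le:
  assumes x: "x \<in> c00" and s: "segment le s"
  shows "(\<Sum>i\<in>s. (x i)\<^sup>2) \<le> (nrm x)\<^sup>2"
proof -
  have "seg_sum {s} x \<le> nrm x powr p"
    using s by (intro seg_sum_le_norm[OF x]) (simp add: seg_family_def)
  also have "nrm x powr p = (nrm x)\<^sup>2 powr (p / 2)"
    using norm_nonneg[OF x] p_gt_2 by (cases "nrm x = 0") (simp_all add: powr_powr flip: powr_numeral)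
  finally have "(\<Sum>i\<in>s. (x i)\<^sup>2) powr (p / 2) \<le> (nrm x)\<^sup>2 powr (p / 2)"
    by (simp add: seg_sum_def)
  then show ?thesis
    by (rule powr_le_imp_le) (use p_gt_2 in \<open>auto intro: sum_nonneg\<close>)
qed

text \<open>Since \<open>p / 2 \<ge> 1\<close>, each segment with square sum
  \<open>T s \<le> M\<close> satisfies
  \<open>T s powr (p / 2) \<le> T s * M powr (p / 2 - 1)\<close>, and the \<open>T s\<close> of
  disjoint segments add up to at most \<open>M\<close>. This bounds the cost of cutting off an
  initial part that is small in l_2.\<close>

lemma norm_le_l2:
  assumes x: "x \<in> c00"
  shows "nrm x \<le> sqrt (sq UNIV x)"
proof -
  define M where "M = sq UNIV x"
  have M0: "M \<ge> 0" by (simp add: M_def sq_nonneg)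
  have "nrm x powr p \<le> M powr (p / 2)"
  proof (rule norm_powr_le[OF x])
    fix S assume S: "seg_family S"
    define T where "T = (\<lambda>s. \<Sum>i\<in>s. (x i)\<^sup>2)"
    have fin: "finite S" "\<And>s. s \<in> S \<Longrightarrow> finite s" and disj: "pairwise disjnt S"
      using S finite_segment by (auto simp: seg_family_def)
    have T0: "T s \<ge> 0" for s by (simp add: T_def sum_nonneg)
    have TM: "T s \<le> M" if "s \<in> S" for s
      unfolding T_def M_def using fin(2)[OF that] x by (intro sum_le_sq) auto
    have "(\<Sum>s\<in>S. T s) = (\<Sum>i\<in>\<Union>S. (x i)\<^sup>2)"
      unfolding T_def using fin disj
      by (subst sum.Union_disjoint) (auto simp: pairwise_def disjnt_def)
    also have "\<dots> \<le> M" unfolding M_def using fin x by (intro sum_le_sq) auto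
    finally have sumT: "(\<Sum>s\<in>S. T s) \<le> M" .
    have "seg_sum S x \<le> (\<Sum>s\<in>S. T s * M powr (p / 2 - 1))"
      unfolding seg_sum_def T_def[symmetric]
    proof (rule sum_mono)
      fix s assume s: "s \<in> S"
      show "T s powr (p / 2) \<le> T s * M powr (p / 2 - 1)"
      proof (cases "T s = 0")
        case False
        then have "T s powr (p / 2) = T s * T s powr (p / 2 - 1)"
          using T0[of s] by (simp add: powr_diff)
        also have "\<dots> \<le> T s * M powr (p / 2 - 1)"
          using T0 TM[OF s] p_gt_2 by (intro mult_left_mono powr_mono2) auto
        finally show ?thesis .
      qed simp
    qed
    also have "\<dots> = (\<Sum>s\<in>S. T s) * M powr (p / 2 - 1)" by (simp add: sum_distrib_right)
    also have "\<dots> \<le> M * M powr (p / 2 - 1)" using sumT by (intro mult_right_mono) auto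
    also have "\<dots> = M powr (p / 2)" using M0 by (cases "M = 0") (auto simp: powr_diff)
    finally show "seg_sum S x \<le> M powr (p / 2)" .
  qed
  also have "M powr (p / 2) = sqrt M powr p"
    using M0 by (simp add: powr_powr flip: powr_half_sqrt)
  finally have "nrm x powr p \<le> sqrt M powr p" .
  then show ?thesis
    unfolding M_def[symmetric] by (rule powr_le_imp_le) (use p_gt_2 norm_nonneg[OF x] M0 in auto)
qed

lemma seg_sum_mask:
  assumes T: "seg_family T" and A: "tree_convex A"
  defines "T' \<equiv> (\<lambda>t. t \<inter> A) ` {t \<in> T. t \<inter> A \<noteq> {}}"
  shows "seg_family T'" "seg_sum T' x = seg_sum T (mask A x)"
proof -
  have fin: "finite T" and seg: "\<And>s. s \<in> T \<Longrightarrow> segment le s" and disj: "pairwise disjnt T"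
    using T by (auto simp: seg_family_def)
  have inj: "inj_on (\<lambda>t. t \<inter> A) {t \<in> T. t \<inter> A \<noteq> {}}"
    using disj unfolding inj_on_def pairwise_def disjnt_def by blast
  have "pairwise disjnt T'"
    unfolding T'_def using disj unfolding pairwise_def disjnt_def by blast
  then show "seg_family T'"
    using fin seg segment_Int[OF _ A] by (auto simp: seg_family_def T'_def)
  have "seg_sum T (mask A x) = (\<Sum>t\<in>T. (\<Sum>i\<in>t \<inter> A. (x i)\<^sup>2) powr (p / 2))"
    unfolding seg_sum_def
    by (intro sum.cong refl) (simp add: sum_mask_sq finite_segment[OF seg])
  also have "\<dots> = (\<Sum>t\<in>{t \<in> T. t \<inter> A \<noteq> {}}. (\<Sum>i\<in>t \<inter> A. (x i)\<^sup>2) powr (p / 2))"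
    using fin by (intro sum.mono_neutral_right) auto
  also have "\<dots> = seg_sum T' x"
    unfolding seg_sum_def T'_def sum.reindex[OF inj] by simp
  finally show "seg_sum T' x = seg_sum T (mask A x)" ..
qed

text \<open>The lower p-estimate: families of segments chosen separately for the masks can be cut
  down to the sets \<open>A i\<close> and then united to one disjoint family.\<close>

lemma sum_norm_mask_le:
  assumes I: "finite I" and x: "x \<in> c00" and disj: "disjoint_family_on A I"
    and conv: "\<And>i. i \<in> I \<Longrightarrow> tree_convex (A i)"
  shows "(\<Sum>i\<in>I. nrm (mask (A i) x) powr p) \<le> nrm x powr p"
proof -
  \<comment> \<open>The suprema are taken one index at a time. \<open>S\<close> collects the
    segments already chosen and stays away from the remaining sets; bounding every \<open>T\<close>
    for the index \<open>j\<close> means applying the induction hypothesis to \<open>S\<close>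
    enlarged by the traces of \<open>T\<close> on \<open>A j\<close>.\<close>
  have "(\<Sum>i\<in>I. nrm (mask (A i) x) powr p) + seg_sum S x \<le> nrm x powr p"
    if "seg_family S" "\<forall>s\<in>S. \<forall>i\<in>I. s \<inter> A i = {}" for S
    using I disj conv that
  proof (induction I arbitrary: S rule: finite_induct)
    case empty
    then show ?case using seg_sum_le_norm[OF x] by simp
  next
    case (insert j I)
    have dI: "disjoint_family_on A I" using insert.prems(1) by (auto simp: disjoint_family_on_def)
    have "nrm (mask (A j) x) powr p
        \<le> nrm x powr p - (\<Sum>i\<in>I. nrm (mask (A i) x) powr p) - seg_sum S x"
    proof (rule norm_powr_le[OF c00_mask[OF x]])
      fix T assume T: "seg_family T"
      define T' where "T' = (\<lambda>t. t \<inter> A j) ` {t \<in> T. t \<inter> A j \<noteq> {}}"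
      have T': "seg_family T'" "seg_sum T' x = seg_sum T (mask (A j) x)"
        using seg_sum_mask[OF T] insert.prems(2) by (auto simp: T'_def)
      have sub: "t \<subseteq> A j" "t \<noteq> {}" if "t \<in> T'" for t using that by (auto simp: T'_def)
      have "S \<inter> T' = {}" using sub insert.prems(4) by fastforce
      then have sum: "seg_sum (S \<union> T') x = seg_sum S x + seg_sum T' x"
        using insert.prems(3) T'(1) unfolding seg_sum_def seg_family_def
        by (intro sum.union_disjoint) auto
      have "pairwise disjnt (S \<union> T')"
        unfolding pairwise_def
      proof (intro ballI impI)
        fix s t assume st: "s \<in> S \<union> T'" "t \<in> S \<union> T'" "s \<noteq> t"
        have 1: "disjnt s t" if "s \<in> S" "t \<in> T'" for s t
          using that sub(1)[of t] insert.prems(4) unfolding disjnt_def by blast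
        have 2: "pairwise disjnt S" "pairwise disjnt T'"
          using insert.prems(3) T'(1) unfolding seg_family_def by blast+
        consider "s \<in> S" "t \<in> S" | "s \<in> S" "t \<in> T'" | "s \<in> T'" "t \<in> S" | "s \<in> T'" "t \<in> T'"
          using st by blast
        then show "disjnt s t"
        proof cases
          case 3
          then show ?thesis using 1[of t s] by (simp add: disjnt_sym)
        qed (use 1 2 st(3) in \<open>auto dest: pairwiseD\<close>)
      qed
      then have fam: "seg_family (S \<union> T')"
        using insert.prems(3) T'(1) unfolding seg_family_def by auto
      have "s \<inter> A i = {}" if "s \<in> S \<union> T'" "i \<in> I" for s i
      proof (cases "s \<in> S")
        case True
        then show ?thesis using insert.prems(4) that by blast
      next
        case False
        then have "s \<subseteq> A j" using sub that by blast
        moreover have "A j \<inter> A i = {}"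
          using disjoint_family_onD[OF insert.prems(1), of j i] insert.hyps that by auto
        ultimately show ?thesis by blast
      qed
      then have "(\<Sum>i\<in>I. nrm (mask (A i) x) powr p) + seg_sum (S \<union> T') x \<le> nrm x powr p"
        using insert.prems(2) by (intro insert.IH dI fam) auto
      then show "seg_sum T (mask (A j) x)
          \<le> nrm x powr p - (\<Sum>i\<in>I. nrm (mask (A i) x) powr p) - seg_sum S x"
        using sum T'(2) by linarith
    qed
    then show ?case using insert.hyps by simp
  qed
  from this[of "{}"] show ?thesis by simp
qed

section \<open>Hilbertian sets\<close>

definition hilbertian :: "nat set \<Rightarrow> bool" where
  "hilbertian F \<longleftrightarrow> (\<exists>K. \<forall>x\<in>c00. sq F x \<le> K * (nrm x)\<^sup>2)"

lemma hilbertian_Un: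
  assumes "hilbertian F" "hilbertian G"
  shows "hilbertian (F \<union> G)"
proof -
  obtain K L where "\<And>x. x \<in> c00 \<Longrightarrow> sq F x \<le> K * (nrm x)\<^sup>2" "\<And>x. x \<in> c00 \<Longrightarrow> sq G x \<le> L * (nrm x)\<^sup>2"
    using assms unfolding hilbertian_def by blast
  then have "sq (F \<union> G) x \<le> (K + L) * (nrm x)\<^sup>2" if "x \<in> c00" for x
    using sq_Un_le[OF that, of F G] that by (fastforce simp: distrib_right)
  then show ?thesis unfolding hilbertian_def by blast
qed

text \<open>The part of the support of \<open>x\<close> in \<open>D\<close> is finite. Its maximal
  nodes form an antichain, so there are at most \<open>K\<close> of them, and each of its nodes lies
  on one of the segments of predecessors of these; every such segment carries at most
  \<open>(nrm x)\<^sup>2\<close>.\<close>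

lemma hilbertian_narrow:
  fixes K :: nat
  assumes narrow: "\<And>A. \<lbrakk>finite A; A \<subseteq> D; \<forall>s\<in>A. \<forall>t\<in>A. le s t \<longrightarrow> s = t\<rbrakk> \<Longrightarrow> card A \<le> K"
  shows "hilbertian D"
  unfolding hilbertian_def
proof (intro exI ballI)
  fix x assume x: "x \<in> c00"
  define G where "G = {i. i \<in> D \<and> x i \<noteq> 0}"
  define M where "M = {t \<in> G. \<forall>u\<in>G. le t u \<longrightarrow> t = u}"
  have G: "finite G" unfolding G_def by (rule finite_subset[OF _ c00D[OF x]]) blast
  then have M: "finite M" by (simp add: M_def)
  have cM: "card M \<le> K" by (rule narrow[OF M]) (auto simp: M_def G_def)
  have "G \<subseteq> (\<Union>t\<in>M. {k. le k t})"
  proof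
    fix i assume i: "i \<in> G"
    \<comment> \<open>The numerically largest node of \<open>G\<close> above \<open>i\<close> is
      maximal in the tree order, because that order is compatible with the usual one.\<close>
    define t where "t = Max {u \<in> G. le i u}"
    have fin: "finite {u \<in> G. le i u}" using G by simp
    have "t \<in> {u \<in> G. le i u}" unfolding t_def using i by (intro Max_in fin) auto
    moreover have "t = u" if "u \<in> G" "le t u" for u
    proof -
      have "le i u" using that calculation le_trans by blast
      then have "u \<le> t" unfolding t_def using that fin by (intro Max_ge) auto
      then show ?thesis using le_imp_leq that by (simp add: le_antisym)
    qed
    ultimately show "i \<in> (\<Union>t\<in>M. {k. le k t})" unfolding M_def by blast
  qed
  moreover have fin: "finite {k. le k t}" for t using segment_down finite_segment by blast
  ultimately have "sq D x \<le> (\<Sum>i\<in>(\<Union>t\<in>M. {k. le k t}). (x i)\<^sup>2)"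
    unfolding sq_def G_def[symmetric] using M by (intro sum_mono2) auto
  also have "\<dots> \<le> (\<Sum>t\<in>M. \<Sum>i\<in>{k. le k t}. (x i)\<^sup>2)"
    using M fin by (intro sum_UN_le) auto
  also have "\<dots> \<le> (\<Sum>t\<in>M. (nrm x)\<^sup>2)"
    by (intro sum_mono segment_sq_le x segment_down)
  also have "\<dots> \<le> real K * (nrm x)\<^sup>2" using cM by (simp add: mult_right_mono)
  finally show "sq D x \<le> real K * (nrm x)\<^sup>2" .
qed

lemma hilbertian_finite: "finite F \<Longrightarrow> hilbertian F"
  by (rule hilbertian_narrow[of _ "card F"]) (simp add: card_mono)

end

section \<open>Block sequences\<close>

text \<open>At most three terms occur, two from \<open>E\<close> and \<open>r\<close>, so the sum is
  at most 3 times the largest of them, and the p-th power of the largest is one of the summands on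
  the right.\<close>

lemma sum_add_powr_le:
  fixes c :: "'b \<Rightarrow> real"
  assumes E: "finite E" "card E \<le> 2" and c: "\<And>n. 0 \<le> c n" and r: "0 \<le> r" and p: "p > 0"
  shows "(sum c E + r) powr p \<le> 3 powr p * ((\<Sum>n\<in>E. c n powr p) + r powr p)"
proof -
  define v where "v = Max (insert r (c ` E))"
  have v: "r \<le> v" "\<And>n. n \<in> E \<Longrightarrow> c n \<le> v" using E by (auto simp: v_def)
  have "sum c E \<le> card E * v" using v by (intro sum_bounded_above) auto
  also have "\<dots> \<le> 2 * v" using E r v by (intro mult_right_mono) auto
  finally have "(sum c E + r) powr p \<le> (3 * v) powr p"
    using v r p c by (intro powr_mono2) (auto intro: add_nonneg_nonneg sum_nonneg)
  also have "\<dots> = 3 powr p * v powr p" using v r by (simp add: powr_mult)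
  also have "v powr p \<le> (\<Sum>n\<in>E. c n powr p) + r powr p"
  proof -
    have "v \<in> insert r (c ` E)" unfolding v_def using E by (intro Max_in) auto
    then consider "v = r" | n where "n \<in> E" "v = c n" by blast
    then show ?thesis
    proof cases
      case 2
      have "c n powr p \<le> (\<Sum>n\<in>E. c n powr p)" using E 2 by (intro member_le_sum) auto
      then show ?thesis using 2 by (simp add: add_increasing2)
    qed (simp add: sum_nonneg)
  qed
  finally show ?thesis by simp
qed

text \<open>Every element of \<open>G\<close> except the least is charged to its immediate
  predecessor in \<open>G\<close>; the predecessors run through all elements except the
  greatest.\<close>

lemma sum_diff_Min_le:
  fixes w c :: "nat \<Rightarrow> real"
  assumes "finite G" "G \<noteq> {}" "\<And>n l. n \<in> G \<Longrightarrow> l \<in> G \<Longrightarrow> n < l \<Longrightarrow> w l \<le> c n"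
  shows "sum w (G - {Min G}) \<le> sum c (G - {Max G})"
  using assms
proof (induction G rule: finite_linorder_max_induct)
  case (insert l G)
  show ?case
  proof (cases "G = {}")
    case False
    have l: "l \<notin> G" using insert.hyps by blast
    have in_G: "Min G \<in> G" "Max G \<in> G" using insert.hyps(1) False by auto
    then have "Min G < l" "Max G < l" using insert.hyps(2) by auto
    then have "Min (insert l G) = Min G" "Max (insert l G) = l"
      using insert.hyps(1) False by (simp_all add: less_imp_le)
    moreover have "Min G \<noteq> l" using \<open>Min G < l\<close> by simp
    moreover have "sum w (insert l G - {Min G}) = w l + sum w (G - {Min G})"
      using l calculation insert.hyps(1) by (simp add: insert_Diff_if)
    moreover have "sum w (G - {Min G}) \<le> sum c (G - {Max G})"
      using False insert.prems(2) by (intro insert.IH) auto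
    moreover have "w l \<le> c (Max G)" using insert.prems(2)[of "Max G" l] in_G \<open>Max G < l\<close> by simp
    moreover have "sum c (insert l G - {l}) = c (Max G) + sum c (G - {Max G})"
      using l sum.remove[OF insert.hyps(1) in_G(2), of c] by simp
    ultimately show ?thesis by simp
  qed simp
qed simp

lemma L2_set_sum_le:
  assumes "finite N"
  shows "L2_set (\<lambda>i. \<Sum>n\<in>N. a n * x n i) s \<le> (\<Sum>n\<in>N. \<bar>a n\<bar> * L2_set (x n) s)"
  using assms
proof (induction N rule: finite_induct)
  case (insert k N)
  have "L2_set (\<lambda>i. a k * x k i + (\<Sum>n\<in>N. a n * x n i)) s
      \<le> L2_set (\<lambda>i. a k * x k i) s + L2_set (\<lambda>i. \<Sum>n\<in>N. a n * x n i) s"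
    by (rule L2_set_triangle_ineq)
  moreover have "L2_set (\<lambda>i. a k * x k i) s = \<bar>a k\<bar> * L2_set (x k) s"
    by (simp add: L2_set_def power_mult_distrib real_sqrt_mult flip: sum_distrib_left)
  ultimately show ?case using insert by simp
qed (simp add: L2_set_def)

section \<open>The embedding of \<open>c00\<close> into the completion\<close>

locale jt_embedding = jt_tree le p for le p +
  fixes J :: "(nat \<Rightarrow> real) \<Rightarrow> 'a::banach" and X :: "'a set"
  assumes JT: "JT_space le p J X"
begin

lemma J_add: "x \<in> c00 \<Longrightarrow> y \<in> c00 \<Longrightarrow> J (\<lambda>i. x i + y i) = J x + J y"
  using JT unfolding JT_space_def seq_linear_on_def by blast

lemma J_scale: "x \<in> c00 \<Longrightarrow> J (\<lambda>i. c * x i) = c *\<^sub>R J x"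
  using JT unfolding JT_space_def seq_linear_on_def by blast

lemma J_diff: "x \<in> c00 \<Longrightarrow> y \<in> c00 \<Longrightarrow> J (\<lambda>i. x i - y i) = J x - J y"
  using J_add[of x "\<lambda>i. - 1 * y i"] J_scale[of y "- 1"] c00_scale[of y "- 1"] by simp

lemma norm_J: "x \<in> c00 \<Longrightarrow> norm (J x) = nrm x"
  using JT unfolding JT_space_def by blast

lemma X_eq: "X = closure (J ` c00)"
  using JT unfolding JT_space_def by blast

lemma norm_scale: "x \<in> c00 \<Longrightarrow> nrm (\<lambda>i. c * x i) = \<bar>c\<bar> * nrm x"
  using norm_J[OF c00_scale[of x c]] by (simp add: J_scale norm_J)

lemma J_zero: "J (\<lambda>_. 0) = 0"
  using J_scale[OF c00_zero, of 0] by simp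

lemma J_sum:
  assumes "finite N" "\<And>n. n \<in> N \<Longrightarrow> x n \<in> c00"
  shows "J (\<lambda>i. \<Sum>n\<in>N. a n * x n i) = (\<Sum>n\<in>N. a n *\<^sub>R J (x n))"
  using assms
  by (induction N rule: finite_induct) (simp_all add: J_zero J_add J_scale c00_scale c00_sum)

end

text \<open>The base 1/4 makes \<open>N * gap N\<close> at most \<open>(1 / 2) ^ N / 16\<close>,
  which is summable; the shift by 2 keeps the total of the errors \<open>2 * gap (M n)\<close> below
  the lower bound 1/2 for the norms of the blocks.\<close>

definition gap :: "nat \<Rightarrow> real" where
  "gap N = (1 / 4) ^ (N + 2)"

lemma gap_pos: "gap N > 0"
  by (simp add: gap_def)

lemma gap_antimono: "M \<le> N \<Longrightarrow> gap N \<le> gap M"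
  unfolding gap_def by (rule power_decreasing) auto

lemma mult_gap_le: "real N * gap N \<le> (1 / 2) ^ N / 16"
proof -
  have "real N \<le> 2 ^ N" using of_nat_less_two_power[of N] by (simp add: less_imp_le)
  then have "real N * (1 / 4) ^ N \<le> 2 ^ N * (1 / 4) ^ N" by (intro mult_right_mono) auto
  also have "\<dots> = (1 / 2) ^ N" by (simp flip: power_mult_distrib)
  finally show ?thesis by (simp add: gap_def)
qed

lemma sum_geometric_le:
  fixes q :: real
  assumes "0 \<le> q" "q < 1"
  shows "(\<Sum>n<L. q ^ n) \<le> 1 / (1 - q)"
  using assms by (simp add: sum_gp_strict divide_right_mono)

text \<open>\<open>M n\<close> is the start of block \<open>n\<close> and also fixes its tolerance.
  Nodes with \<open>m \<ge> gap (M n)\<close> are heavy for block \<open>n\<close>, which is small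
  in l_2 on them; above any node \<open>t\<close> before its start, the block is controlled by
  \<open>m t\<close>.\<close>

locale block_sequence = jt_embedding +
  fixes x :: "nat \<Rightarrow> nat \<Rightarrow> real" and M :: "nat \<Rightarrow> nat" and m :: "nat \<Rightarrow> real"
  assumes mono_M: "strict_mono M"
    and x_c00: "x n \<in> c00"
    and supp: "x n i \<noteq> 0 \<Longrightarrow> M n \<le> i \<and> i < M (Suc n)"
    and heavy_small: "sq {t. gap (M n) \<le> m t} (x n) < (gap (M n))\<^sup>2"
    and light_small: "t < M n \<Longrightarrow> nrm (mask {s. le t s} (x n)) \<le> m t + gap (M n)"
    and norm_le_2: "nrm (x n) \<le> 2"
    and norm_ge_half: "1 / 2 \<le> nrm (x n)"
begin

definition w :: "nat set \<Rightarrow> nat \<Rightarrow> real" where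
  "w s n = L2_set (x n) s"

lemma w_nonneg: "0 \<le> w s n"
  by (simp add: w_def)

lemma M_less: "n < l \<Longrightarrow> M (Suc n) \<le> M l"
  using mono_M by (simp add: strict_mono_less_eq Suc_le_eq)

lemma w_zero:
  assumes "segment le s" "M (Suc n) \<le> Min s"
  shows "w s n = 0"
proof -
  have "x n i = 0" if "i \<in> s" for i
    using supp[of n i] Min_le[OF finite_segment[OF assms(1)] that] assms(2) by fastforce
  then show ?thesis by (simp add: w_def L2_set_def)
qed

text \<open>The block \<open>n\<close> cannot be heavy on \<open>s\<close> at nodes with \<open>m \<ge> gap (M n)\<close> only, so \<open>s\<close> passes through
  a node with small \<open>m\<close>; all later blocks on \<open>s\<close> live in the subtree above that node.\<close>

lemma later_small:
  assumes s: "segment le s" and n: "gap (M n) \<le> w s n" and nl: "n < l"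
  shows "w s l \<le> 2 * gap (M n)"
proof -
  have fin: "finite s" using s by (rule finite_segment)
  obtain i where i: "i \<in> s" "x n i \<noteq> 0" "m i < gap (M n)"
  proof -
    have "\<not> (\<forall>i\<in>s. x n i \<noteq> 0 \<longrightarrow> gap (M n) \<le> m i)"
    proof
      assume "\<forall>i\<in>s. x n i \<noteq> 0 \<longrightarrow> gap (M n) \<le> m i"
      then have "(\<Sum>i\<in>s. (x n i)\<^sup>2) \<le> sq {t. gap (M n) \<le> m t} (x n)"
        using x_c00 fin by (intro sum_le_sq) auto
      then have "(w s n)\<^sup>2 < (gap (M n))\<^sup>2"
        using heavy_small[of n] by (simp add: w_def L2_set_def sum_nonneg)
      then show False using power_mono[OF n less_imp_le[OF gap_pos], of 2] by linarith
    qed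
    then obtain i where "i \<in> s" "x n i \<noteq> 0" "m i < gap (M n)" by (auto simp: not_le)
    then show ?thesis by (rule that)
  qed
  \<comment> \<open>Block \<open>n\<close> ends before block \<open>l\<close> starts, so
    \<open>light_small\<close> applies to block \<open>l\<close> at the node \<open>i\<close>; as
    \<open>s\<close> is a chain, all its nodes in block \<open>l\<close> lie above
    \<open>i\<close>.\<close>
  have iM: "i < M l" using supp[OF i(2)] M_less[OF nl] by simp
  have "(\<Sum>j\<in>s. (x l j)\<^sup>2) = (\<Sum>j\<in>s. (mask {t. le i t} (x l) j)\<^sup>2)"
  proof (rule sum.cong[OF refl])
    fix j assume j: "j \<in> s"
    show "(x l j)\<^sup>2 = (mask {t. le i t} (x l) j)\<^sup>2"
    proof (cases "x l j = 0")
      case False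
      then have "le i j" using supp[of l j] iM by (intro segment_chain[OF s i(1) j]) auto
      then show ?thesis by (simp add: mask_def)
    qed (simp add: mask_def)
  qed
  also have "\<dots> \<le> (nrm (mask {t. le i t} (x l)))\<^sup>2"
    by (intro segment_sq_le c00_mask x_c00 s)
  finally have "w s l \<le> nrm (mask {t. le i t} (x l))"
    unfolding w_def L2_set_def by (intro real_le_lsqrt norm_nonneg c00_mask x_c00)
  also have "\<dots> \<le> m i + gap (M l)" by (rule light_small[OF iM])
  also have "\<dots> \<le> 2 * gap (M n)"
    using i(3) gap_antimono[of "M n" "M l"] mono_M nl by (simp add: strict_mono_less less_imp_le)
  finally show ?thesis .
qed

text \<open>The factor 3 is 1 + 2: block \<open>n\<close> itself contributes at most
  \<open>gap (M n)\<close> if its weight on \<open>s\<close> is below that, and otherwise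
  \<open>later_small\<close> charges \<open>2 * gap (M n)\<close> to it for the next block that is
  heavy on \<open>s\<close>.\<close>

definition rest :: "nat \<Rightarrow> nat set \<Rightarrow> real" where
  "rest L s = (\<Sum>n | n < L \<and> Min s < M n. 3 * gap (M n))"

lemma rest_nonneg: "0 \<le> rest L s"
  unfolding rest_def using gap_pos by (intro sum_nonneg) (simp add: less_imp_le)

text \<open>The exceptions are the block containing the first node of \<open>s\<close> and the first later block that is
  heavy on \<open>s\<close>. The index set in \<open>rest\<close> excludes the blocks up to the first node of \<open>s\<close>: this
  bounds by \<open>M n\<close> the number of disjoint segments to which \<open>n\<close> contributes.\<close>

lemma two_exceptions:
  assumes s: "segment le s"
  shows "\<exists>E. E \<subseteq> {..<L} \<and> card E \<le> 2 \<and> sum (w s) ({..<L} - E) \<le> rest L s"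
proof -
  define H where "H = {n. n < L \<and> Min s < M n}"
  define E1 where "E1 = {n. n < L \<and> M n \<le> Min s \<and> w s n \<noteq> 0}"
  define G where "G = {n \<in> H. gap (M n) \<le> w s n}"
  define E2 where "E2 = (if G = {} then {} else {Min G})"
  have fin: "finite E1" "finite G" "finite H" "finite E2"
    by (auto simp: E1_def G_def H_def E2_def)
  \<comment> \<open>Of two different blocks starting no later than the first node of
    \<open>s\<close>, the earlier one has ended before \<open>s\<close> begins and is therefore zero
    on \<open>s\<close>.\<close>
  have "n = l" if "n \<in> E1" "l \<in> E1" for n l
  proof -
    have False if "n \<in> E1" "l \<in> E1" "n < l" for n l
      using that w_zero[OF s, of n] M_less[OF that(3)] by (auto simp: E1_def)
    then show ?thesis using that by (cases n l rule: linorder_cases) auto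
  qed
  then have "card E1 \<le> 1" using fin by (simp add: card_le_Suc0_iff_eq)
  moreover have "card E2 \<le> 1" by (simp add: E2_def)
  ultimately have card: "card (E1 \<union> E2) \<le> 2" using card_Un_le[of E1 E2] by linarith
  have E2G: "E2 \<subseteq> G" using fin by (simp add: E2_def)
  have sub: "E1 \<union> E2 \<subseteq> {..<L}" using E2G by (auto simp: E1_def G_def H_def)
  have "sum (w s) ({..<L} - (E1 \<union> E2)) = sum (w s) (H - E2)"
    using E2G by (intro sum.mono_neutral_right) (auto simp: E1_def H_def G_def)
  also have "\<dots> = sum (w s) ((H - G) \<union> (G - E2))"
    using E2G by (intro arg_cong[where f = "sum (w s)"]) (auto simp: G_def)
  also have "\<dots> = sum (w s) (H - G) + sum (w s) (G - E2)"
    using fin by (intro sum.union_disjoint) auto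
  also have "sum (w s) (G - E2) \<le> (\<Sum>n\<in>G. 2 * gap (M n))"
  proof (cases "G = {}")
    case False
    have "sum (w s) (G - {Min G}) \<le> (\<Sum>n\<in>G - {Max G}. 2 * gap (M n))"
      using fin False by (intro sum_diff_Min_le later_small[OF s]) (auto simp: G_def)
    also have "\<dots> \<le> (\<Sum>n\<in>G. 2 * gap (M n))"
      using fin gap_pos by (intro sum_mono2) (auto intro: less_imp_le)
    finally show ?thesis using False by (simp add: E2_def)
  qed simp
  also have "\<dots> \<le> (\<Sum>n\<in>H. 2 * gap (M n))"
    using fin gap_pos by (intro sum_mono2) (auto intro: less_imp_le simp: G_def)
  also have "sum (w s) (H - G) \<le> (\<Sum>n\<in>H - G. gap (M n))"
    by (intro sum_mono) (auto simp: G_def)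
  also have "\<dots> \<le> (\<Sum>n\<in>H. gap (M n))"
    using fin gap_pos by (intro sum_mono2) (auto intro: less_imp_le)
  finally have "sum (w s) ({..<L} - (E1 \<union> E2)) \<le> rest L s"
    by (simp add: rest_def H_def[symmetric] flip: sum.distrib)
  then show ?thesis using sub card by blast
qed

lemma M_ge: "n \<le> M n"
  using mono_M by (rule strict_mono_imp_increasing)

text \<open>Disjoint segments have distinct first nodes, so at most \<open>M n\<close> of them start
  before \<open>M n\<close>. Block \<open>n\<close> thus costs at most
  \<open>M n * (3 * gap (M n))\<close> in all, and the total is at most 3/8.\<close>

lemma sum_rest_le:
  assumes S: "seg_family S"
  shows "(\<Sum>s\<in>S. rest L s) \<le> 1"
proof -
  have fin: "finite S" and seg: "\<And>s. s \<in> S \<Longrightarrow> segment le s" and disj: "pairwise disjnt S"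
    using S by (auto simp: seg_family_def)
  have Min_s: "Min s \<in> s" if "s \<in> S" for s
    by (intro Min_in finite_segment segment_nonempty seg that)
  have inj: "inj_on Min S"
  proof (rule inj_onI, rule ccontr)
    fix s t assume st: "s \<in> S" "t \<in> S" "Min s = Min t" "s \<noteq> t"
    then have "disjnt s t" using disj by (simp add: pairwise_def)
    then show False using Min_s[OF st(1)] Min_s[OF st(2)] st(3) by (auto simp: disjnt_iff)
  qed
  have "(\<Sum>s\<in>S. rest L s) = (\<Sum>s\<in>S. \<Sum>n<L. if Min s < M n then 3 * gap (M n) else 0)"
    unfolding rest_def by (intro sum.cong refl sum.mono_neutral_cong_left) auto
  also have "\<dots> = (\<Sum>n<L. \<Sum>s\<in>S. if Min s < M n then 3 * gap (M n) else 0)"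
    by (rule sum.swap)
  also have "\<dots> = (\<Sum>n<L. card {s \<in> S. Min s < M n} * (3 * gap (M n)))"
    using fin by (intro sum.cong refl) (simp add: sum.If_cases Int_def)
  also have "\<dots> \<le> (\<Sum>n<L. 3 / 16 * (1 / 2) ^ n)"
  proof (rule sum_mono)
    fix n
    have "card {s \<in> S. Min s < M n} \<le> card {..<M n}"
      using inj by (intro card_inj_on_le[of Min]) (auto intro: inj_on_subset)
    then have "card {s \<in> S. Min s < M n} * (3 * gap (M n)) \<le> M n * (3 * gap (M n))"
      using gap_pos[of "M n"] by (intro mult_right_mono) auto
    also have "\<dots> \<le> 3 / 16 * (1 / 2) ^ M n" using mult_gap_le[of "M n"] by (simp add: mult_ac)
    also have "\<dots> \<le> 3 / 16 * (1 / 2) ^ n"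
      using M_ge by (intro mult_left_mono power_decreasing) auto
    finally show "card {s \<in> S. Min s < M n} * (3 * gap (M n)) \<le> 3 / 16 * (1 / 2) ^ n" .
  qed
  also have "\<dots> = 3 / 16 * (\<Sum>n<L. (1 / 2) ^ n)" by (simp add: sum_distrib_left)
  also have "\<dots> \<le> 3 / 16 * 2"
    using sum_geometric_le[of "1 / 2" L] by (intro mult_left_mono) auto
  finally show ?thesis by simp
qed

section \<open>Upper and lower p-estimates for the blocks\<close>

lemma upper_estimate:
  "nrm (\<lambda>i. \<Sum>n<L. a n * x n i) powr p
     \<le> 3 powr p * (2 powr p + 1) * (\<Sum>n<L. \<bar>a n\<bar> powr p)"
proof (rule norm_powr_le)
  show "(\<lambda>i. \<Sum>n<L. a n * x n i) \<in> c00" by (intro c00_sum c00_scale x_c00) auto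
  fix S assume S: "seg_family S"
  have fin: "finite S" and seg: "\<And>s. s \<in> S \<Longrightarrow> segment le s"
    using S by (auto simp: seg_family_def)
  define A where "A = (\<Sum>n<L. \<bar>a n\<bar> powr p) powr (1 / p)"
  have A0: "A \<ge> 0" by (simp add: A_def)
  have Ap: "A powr p = (\<Sum>n<L. \<bar>a n\<bar> powr p)"
    using p_gt_2 by (simp add: A_def powr_powr sum_nonneg)
  have aA: "\<bar>a n\<bar> \<le> A" if "n < L" for n
  proof -
    have "\<bar>a n\<bar> powr p \<le> A powr p" unfolding Ap using that by (intro member_le_sum) auto
    then show ?thesis by (rule powr_le_imp_le) (use p_gt_2 A0 in auto)
  qed
  \<comment> \<open>Outside the two exceptional blocks every coefficient is replaced by
    \<open>A\<close>, the l_p norm of all coefficients, and the weights sum to at most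
    \<open>rest L s\<close>.\<close>
  have one: "(\<Sum>i\<in>s. (\<Sum>n<L. a n * x n i)\<^sup>2) powr (p / 2)
      \<le> 3 powr p * ((\<Sum>n<L. \<bar>a n\<bar> powr p * w s n powr p) + A powr p * rest L s)" if s: "s \<in> S" for s
  proof -
    obtain E where E: "E \<subseteq> {..<L}" "card E \<le> 2" "sum (w s) ({..<L} - E) \<le> rest L s"
      using two_exceptions[OF seg[OF s]] by blast
    have finE: "finite E" using E(1) finite_subset by blast
    have rest1: "rest L s \<le> 1"
      using sum_rest_le[OF S, of L] member_le_sum[OF s, of "rest L"] fin rest_nonneg by fastforce
    have "L2_set (\<lambda>i. \<Sum>n<L. a n * x n i) s \<le> (\<Sum>n<L. \<bar>a n\<bar> * w s n)"
      unfolding w_def by (rule L2_set_sum_le) simp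
    also have "\<dots> = (\<Sum>n\<in>E. \<bar>a n\<bar> * w s n) + (\<Sum>n\<in>{..<L} - E. \<bar>a n\<bar> * w s n)"
      using E(1) by (simp add: sum.subset_diff add.commute)
    also have "(\<Sum>n\<in>{..<L} - E. \<bar>a n\<bar> * w s n) \<le> (\<Sum>n\<in>{..<L} - E. A * w s n)"
      using aA w_nonneg by (intro sum_mono mult_right_mono) auto
    also have "\<dots> \<le> A * rest L s"
      using E(3) A0 by (simp add: mult_left_mono flip: sum_distrib_left)
    finally have "L2_set (\<lambda>i. \<Sum>n<L. a n * x n i) s powr p
        \<le> ((\<Sum>n\<in>E. \<bar>a n\<bar> * w s n) + A * rest L s) powr p"
      using p_gt_2 by (intro powr_mono2) auto
    also have "\<dots> \<le> 3 powr p * ((\<Sum>n\<in>E. (\<bar>a n\<bar> * w s n) powr p) + (A * rest L s) powr p)"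
      using finE E(2) w_nonneg A0 rest_nonneg p_gt_2 by (intro sum_add_powr_le) auto
    also have "(\<Sum>n\<in>E. (\<bar>a n\<bar> * w s n) powr p) \<le> (\<Sum>n<L. (\<bar>a n\<bar> * w s n) powr p)"
      using E(1) by (intro sum_mono2) auto
    also have "\<dots> = (\<Sum>n<L. \<bar>a n\<bar> powr p * w s n powr p)"
      using w_nonneg by (simp add: powr_mult)
    also have "(A * rest L s) powr p = A powr p * rest L s powr p"
      using A0 rest_nonneg by (simp add: powr_mult)
    \<comment> \<open>Since \<open>rest L s \<le> 1\<close>, its p-th power is at most
      \<open>rest L s\<close>, and in this linear form \<open>sum_rest_le\<close> can sum it over
      the segments.\<close>
    also have "rest L s powr p \<le> rest L s powr 1"
      using rest1 rest_nonneg[of L s] p_gt_2 by (intro powr_mono') auto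
    also have "\<dots> = rest L s" using rest_nonneg by simp
    finally have "L2_set (\<lambda>i. \<Sum>n<L. a n * x n i) s powr p
        \<le> 3 powr p * ((\<Sum>n<L. \<bar>a n\<bar> powr p * w s n powr p) + A powr p * rest L s)"
      by (simp add: mult_left_mono)
    then show ?thesis by (simp add: L2_set_def powr_powr sum_nonneg flip: powr_half_sqrt)
  qed
  have sum_w: "(\<Sum>s\<in>S. w s n powr p) \<le> 2 powr p" for n
  proof -
    have "(\<Sum>s\<in>S. w s n powr p) = seg_sum S (x n)"
      by (simp add: w_def seg_sum_def L2_set_def powr_powr sum_nonneg flip: powr_half_sqrt)
    also have "\<dots> \<le> nrm (x n) powr p" by (rule seg_sum_le_norm[OF x_c00 S])
    also have "\<dots> \<le> 2 powr p"
      using norm_le_2 norm_nonneg[OF x_c00] p_gt_2 by (intro powr_mono2) auto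
    finally show ?thesis .
  qed
  have "seg_sum S (\<lambda>i. \<Sum>n<L. a n * x n i)
      \<le> (\<Sum>s\<in>S. 3 powr p * ((\<Sum>n<L. \<bar>a n\<bar> powr p * w s n powr p) + A powr p * rest L s))"
    unfolding seg_sum_def by (rule sum_mono[OF one])
  also have "\<dots> = 3 powr p * ((\<Sum>n<L. \<bar>a n\<bar> powr p * (\<Sum>s\<in>S. w s n powr p))
      + A powr p * (\<Sum>s\<in>S. rest L s))"
  proof -
    have "(\<Sum>s\<in>S. \<Sum>n<L. \<bar>a n\<bar> powr p * w s n powr p) = (\<Sum>n<L. \<bar>a n\<bar> powr p * (\<Sum>s\<in>S. w s n powr p))"
      by (subst sum.swap) (simp add: sum_distrib_left)
    then show ?thesis by (simp add: sum.distrib flip: sum_distrib_left)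
  qed
  \<comment> \<open>The term \<open>2 powr p\<close> is the contribution of a block of norm at most
    2 to a disjoint family, the 1 is the sum of the rests.\<close>
  also have "\<dots> \<le> 3 powr p * ((\<Sum>n<L. \<bar>a n\<bar> powr p * 2 powr p) + A powr p * 1)"
    using sum_w sum_rest_le[OF S] by (intro mult_left_mono add_mono sum_mono) auto
  also have "\<dots> = 3 powr p * (2 powr p + 1) * (\<Sum>n<L. \<bar>a n\<bar> powr p)"
    by (simp add: Ap algebra_simps flip: sum_distrib_right)
  finally show "seg_sum S (\<lambda>i. \<Sum>n<L. a n * x n i)
      \<le> 3 powr p * (2 powr p + 1) * (\<Sum>n<L. \<bar>a n\<bar> powr p)" .
qed

text \<open>The blocks live on disjoint intervals of natural numbers, which are tree-convex, so
  \<open>sum_norm_mask_le\<close> separates them; the factor 1/2 is the lower bound for their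
  norms.\<close>

lemma lower_estimate:
  "(1 / 2) powr p * (\<Sum>n<L. \<bar>a n\<bar> powr p) \<le> nrm (\<lambda>i. \<Sum>n<L. a n * x n i) powr p"
proof -
  define A where "A = (\<lambda>n. {M n..<M (Suc n)})"
  define z where "z = (\<lambda>i. \<Sum>n<L. a n * x n i)"
  have z: "z \<in> c00" unfolding z_def by (intro c00_sum c00_scale x_c00) auto
  have disj: "A n \<inter> A l = {}" if "n < l" for n l
    using M_less[OF that] by (auto simp: A_def)
  then have "disjoint_family_on A {..<L}"
    unfolding disjoint_family_on_def by (metis inf_commute linorder_neqE_nat)
  moreover have "tree_convex (A n)" for n
    unfolding tree_convex_def A_def using le_imp_leq by (meson atLeastLessThan_iff le_less_trans order_trans)
  ultimately have "(\<Sum>n<L. nrm (mask (A n) z) powr p) \<le> nrm z powr p"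
    by (intro sum_norm_mask_le z) auto
  moreover have "(1 / 2) powr p * \<bar>a n\<bar> powr p \<le> nrm (mask (A n) z) powr p" if n: "n < L" for n
  proof -
    have "mask (A n) z = (\<lambda>i. a n * x n i)"
    proof
      fix i
      show "mask (A n) z i = a n * x n i"
      proof (cases "i \<in> A n")
        case True
        have "a l * x l i = 0" if "l \<noteq> n" for l
          using supp[of l i] disj[of l n] disj[of n l] that True unfolding A_def by fastforce
        then have "z i = (\<Sum>l\<in>{n}. a l * x l i)"
          unfolding z_def using n by (intro sum.mono_neutral_right) auto
        then show ?thesis using True by (simp add: mask_def)
      next
        case False
        then show ?thesis using supp[of n i] by (auto simp: mask_def A_def)
      qed
    qed
    then have "nrm (mask (A n) z) = \<bar>a n\<bar> * nrm (x n)" by (simp add: norm_scale x_c00)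
    moreover have "1 / 2 * \<bar>a n\<bar> \<le> \<bar>a n\<bar> * nrm (x n)"
      using mult_left_mono[OF norm_ge_half[of n], of "\<bar>a n\<bar>"] by (simp add: mult.commute)
    then have "(1 / 2 * \<bar>a n\<bar>) powr p \<le> (\<bar>a n\<bar> * nrm (x n)) powr p"
      using p_gt_2 by (intro powr_mono2) auto
    ultimately show ?thesis by (simp add: powr_mult powr_divide)
  qed
  then have "(1 / 2) powr p * (\<Sum>n<L. \<bar>a n\<bar> powr p) \<le> (\<Sum>n<L. nrm (mask (A n) z) powr p)"
    unfolding sum_distrib_left by (intro sum_mono) auto
  ultimately show ?thesis unfolding z_def by linarith
qed

lemma sum_gap_le: "(\<Sum>n<L. 2 * gap (M n)) \<le> 1 / 4"
proof -
  have "(\<Sum>n<L. 2 * gap (M n)) \<le> (\<Sum>n<L. 1 / 8 * (1 / 4) ^ n)"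
  proof (rule sum_mono)
    fix n
    have "gap (M n) \<le> gap n" by (rule gap_antimono[OF M_ge])
    then show "2 * gap (M n) \<le> 1 / 8 * (1 / 4) ^ n" by (simp add: gap_def)
  qed
  also have "\<dots> = 1 / 8 * (\<Sum>n<L. (1 / 4) ^ n)" by (simp add: sum_distrib_left)
  also have "\<dots> \<le> 1 / 8 * (4 / 3)"
    using sum_geometric_le[of "1 / 4" L] by (intro mult_left_mono) auto
  finally show ?thesis by simp
qed

text \<open>Each coefficient is at most \<open>A\<close>, so passing from \<open>J (x n)\<close> to
  \<open>y n\<close> changes a sum by at most \<open>A * (1 / 4)\<close>. The lower constant drops
  from 1/2 to 1/4, the upper one rises from \<open>C\<close> to \<open>C + 1 / 4\<close>.\<close>

lemma perturbation_isomorphic_to_lp: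
  assumes y: "\<And>n. norm (J (x n) - y n) \<le> 2 * gap (M n)"
  shows "isomorphic_to_lp p (closure (span (range y)))"
proof (rule isomorphic_to_lp_closure_span)
  define C where "C = (3 powr p * (2 powr p + 1)) powr (1 / p)"
  show "p \<ge> 1" using p_gt_2 by simp
  show "(1 / 4 :: real) > 0" by simp
  show "0 \<le> C + 1 / 4" by (simp add: C_def)
  fix a :: "nat \<Rightarrow> real" and L
  define A where "A = (\<Sum>n<L. \<bar>a n\<bar> powr p) powr (1 / p)"
  define z where "z = (\<lambda>i. \<Sum>n<L. a n * x n i)"
  define v where "v = (\<Sum>n<L. a n *\<^sub>R y n)"
  have A0: "A \<ge> 0" by (simp add: A_def)
  have Ap: "A powr p = (\<Sum>n<L. \<bar>a n\<bar> powr p)"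
    using p_gt_2 by (simp add: A_def powr_powr sum_nonneg)
  have zc: "z \<in> c00" unfolding z_def by (intro c00_sum c00_scale x_c00) auto
  have "((1 / 2) * A) powr p \<le> nrm z powr p"
    unfolding powr_mult[of "1 / 2" A] Ap z_def by (rule lower_estimate)
  then have low: "1 / 2 * A \<le> nrm z"
    by (rule powr_le_imp_le) (use p_gt_2 A0 norm_nonneg[OF zc] in auto)
  have "nrm z powr p \<le> (C * A) powr p"
    using upper_estimate[where L = L and a = a] A0 p_gt_2
    by (simp add: powr_mult Ap z_def C_def powr_powr)
  then have up: "nrm z \<le> C * A"
    by (rule powr_le_imp_le) (use p_gt_2 A0 norm_nonneg[OF zc] in \<open>auto simp: C_def\<close>)
  have aA: "\<bar>a n\<bar> \<le> A" if "n < L" for n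
  proof -
    have "\<bar>a n\<bar> powr p \<le> A powr p" unfolding Ap using that by (intro member_le_sum) auto
    then show ?thesis by (rule powr_le_imp_le) (use p_gt_2 A0 in auto)
  qed
  have "J z - v = (\<Sum>n<L. a n *\<^sub>R (J (x n) - y n))"
    unfolding z_def v_def by (simp add: J_sum x_c00 sum_subtractf scaleR_diff_right)
  also have "norm \<dots> \<le> (\<Sum>n<L. A * (2 * gap (M n)))"
    using aA y A0 by (intro sum_norm_le) (auto intro!: mult_mono)
  also have "\<dots> \<le> A * (1 / 4)"
    using mult_left_mono[OF sum_gap_le[of L] A0] by (simp only: sum_distrib_left)
  finally have "norm (J z - v) \<le> A * (1 / 4)" .
  moreover have "norm (J z) = nrm z" by (rule norm_J[OF zc])
  moreover have "norm (J z) - norm v \<le> norm (J z - v)" "norm v - norm (J z) \<le> norm (J z - v)"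
    using norm_triangle_ineq2[of "J z" v] norm_triangle_ineq2[of v "J z"]
    by (simp_all only: norm_minus_commute[of v "J z"])
  moreover have "(C + 1 / 4) * A = C * A + A * (1 / 4)" by (simp add: distrib_right)
  ultimately have "1 / 4 * A \<le> norm v" "norm v \<le> (C + 1 / 4) * A" using low up by linarith+
  then show "1 / 4 * (\<Sum>n<L. \<bar>a n\<bar> powr p) powr (1 / p) \<le> norm (\<Sum>n<L. a n *\<^sub>R y n)"
    "norm (\<Sum>n<L. a n *\<^sub>R y n) \<le> (C + 1 / 4) * (\<Sum>n<L. \<bar>a n\<bar> powr p) powr (1 / p)"
    unfolding A_def v_def .
qed

end

section \<open>Subspaces on which a hilbertian restriction is bounded below\<close>

text \<open>The inner product of l_2 over \<open>F\<close>. The support of the first argument alone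
  makes the sum finite; symmetry therefore needs the proof in \<open>ip_sym\<close>.\<close>

definition ip :: "nat set \<Rightarrow> (nat \<Rightarrow> real) \<Rightarrow> (nat \<Rightarrow> real) \<Rightarrow> real" where
  "ip F x y = (\<Sum>i | i \<in> F \<and> x i \<noteq> 0. x i * y i)"

lemma ip_eq_sum:
  assumes "finite G" "\<And>i. i \<in> F \<Longrightarrow> x i \<noteq> 0 \<Longrightarrow> i \<in> G" "G \<subseteq> F"
  shows "ip F x y = (\<Sum>i\<in>G. x i * y i)"
  unfolding ip_def using assms by (intro sum.mono_neutral_left) auto

lemma ip_self: "ip F x x = sq F x"
  by (simp add: ip_def sq_def power2_eq_square)

lemma ip_sym:
  assumes "x \<in> c00" "y \<in> c00"
  shows "ip F x y = ip F y x"
proof -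
  define G where "G = F \<inter> ({i. x i \<noteq> 0} \<union> {i. y i \<noteq> 0})"
  have "finite G" using assms by (auto simp: G_def c00_def)
  then have "ip F x y = (\<Sum>i\<in>G. x i * y i)" "ip F y x = (\<Sum>i\<in>G. y i * x i)"
    by (auto intro!: ip_eq_sum simp: G_def)
  then show ?thesis by (simp add: mult.commute)
qed

lemma ip_add:
  assumes "x \<in> c00" "y \<in> c00"
  shows "ip F (\<lambda>i. x i + y i) z = ip F x z + ip F y z"
proof -
  define G where "G = F \<inter> ({i. x i \<noteq> 0} \<union> {i. y i \<noteq> 0})"
  have "finite G" using assms by (auto simp: G_def c00_def)
  then have "ip F x z = (\<Sum>i\<in>G. x i * z i)" "ip F y z = (\<Sum>i\<in>G. y i * z i)"
    "ip F (\<lambda>i. x i + y i) z = (\<Sum>i\<in>G. (x i + y i) * z i)"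
    by (auto intro!: ip_eq_sum simp: G_def)
  then show ?thesis by (simp add: distrib_right sum.distrib)
qed

lemma ip_scale: "ip F (\<lambda>i. c * x i) z = c * ip F x z"
  by (cases "c = 0") (simp_all add: ip_def sum_distrib_left mult.assoc)

lemma ip_diff:
  assumes "x \<in> c00" "y \<in> c00"
  shows "ip F (\<lambda>i. x i - y i) z = ip F x z - ip F y z"
  using ip_add[OF assms(1) c00_scale[OF assms(2), of "- 1"]] ip_scale[of F "- 1" y z] by simp

lemma abs_ip_le:
  assumes "x \<in> c00" "y \<in> c00"
  shows "\<bar>ip F x y\<bar> \<le> sqrt (sq F x) * sqrt (sq F y)"
proof -
  define G where "G = F \<inter> ({i. x i \<noteq> 0} \<union> {i. y i \<noteq> 0})"
  have G: "finite G" using assms by (auto simp: G_def c00_def)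
  then have "\<bar>ip F x y\<bar> = \<bar>\<Sum>i\<in>G. x i * y i\<bar>"
    by (subst ip_eq_sum[of G]) (auto simp: G_def)
  also have "\<dots> \<le> (\<Sum>i\<in>G. \<bar>x i\<bar> * \<bar>y i\<bar>)" by (rule order_trans[OF sum_abs]) (simp add: abs_mult)
  also have "\<dots> \<le> L2_set x G * L2_set y G" by (rule L2_set_mult_ineq)
  also have "\<dots> = sqrt (sq F x) * sqrt (sq F y)"
    using G by (simp add: L2_set_def sq_eq_sum[of G] G_def)
  finally show ?thesis .
qed

section \<open>Extension of the inner product to the completion\<close>

context jt_embedding
begin

lemma approximating_sequence:
  assumes "x \<in> X"
  shows "\<exists>u. (\<forall>n. u n \<in> c00) \<and> (\<lambda>n. J (u n)) \<longlonglongrightarrow> x"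
proof -
  have "x \<in> closure (J ` c00)" using assms X_eq by simp
  then obtain z where z: "\<And>n. z n \<in> J ` c00" "z \<longlonglongrightarrow> x"
    unfolding closure_sequential by blast
  have "\<exists>u. u \<in> c00 \<and> J u = z n" for n
    using z(1)[of n] by (rule imageE) auto
  then obtain u where u: "\<And>n. u n \<in> c00" "\<And>n. J (u n) = z n" by metis
  show ?thesis using u z(2) by (intro exI[of _ u]) simp
qed

text \<open>\<open>B\<close> is the limit of \<open>ip F\<close> along one chosen approximating
  sequence for each point of \<open>X\<close>. The second conclusion, for arbitrary approximating
  sequences, allows lower bounds on finitely supported approximants to pass to
  \<open>B\<close>.\<close>

lemma form_exists:
  assumes K: "K > 0" and F: "\<And>x. x \<in> c00 \<Longrightarrow> sq F x \<le> K * (nrm x)\<^sup>2"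
  shows "\<exists>B. bounded_form X B K \<and>
    (\<forall>x\<in>X. \<forall>u. (\<forall>n. u n \<in> c00) \<longrightarrow> (\<lambda>n. J (u n)) \<longlonglongrightarrow> x \<longrightarrow> (\<lambda>n. sq F (u n)) \<longlonglongrightarrow> B x x)"
proof -
  have bnd: "\<bar>ip F x y\<bar> \<le> K * norm (J x) * norm (J y)" if "x \<in> c00" "y \<in> c00" for x y
  proof -
    have s: "sqrt (sq F x) \<le> sqrt K * norm (J x)" if "x \<in> c00" for x
      using real_sqrt_le_mono[OF F[OF that]] norm_nonneg[OF that]
      by (simp add: real_sqrt_mult norm_J that)
    have "sqrt (sq F x) * sqrt (sq F y) \<le> (sqrt K * norm (J x)) * (sqrt K * norm (J y))"
      using s that K by (intro mult_mono) (auto simp: sq_nonneg)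
    also have "\<dots> = (sqrt K * sqrt K) * norm (J x) * norm (J y)" by (simp only: mult_ac)
    also have "sqrt K * sqrt K = K" using K by simp
    finally show ?thesis using abs_ip_le[OF that, of F] by linarith
  qed
  \<comment> \<open>This Lipschitz estimate serves twice: it makes the chosen values Cauchy, and it
    shows that the limit does not depend on the choice.\<close>
  have diff: "\<bar>ip F u v - ip F u' v'\<bar> \<le> K * norm (J u - J u') * norm (J v) + K * norm (J u') * norm (J v - J v')"
    if c: "u \<in> c00" "v \<in> c00" "u' \<in> c00" "v' \<in> c00" for u v u' v'
  proof -
    have "ip F u v - ip F u' v' = ip F (\<lambda>i. u i - u' i) v + ip F (\<lambda>i. v i - v' i) u'"
      using c by (simp add: ip_diff ip_sym[of u' v] ip_sym[of u' v'])
    moreover have "\<bar>ip F (\<lambda>i. u i - u' i) v\<bar> \<le> K * norm (J u - J u') * norm (J v)"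
      using bnd[OF c00_diff[OF c(1,3)] c(2)] c by (simp add: J_diff)
    moreover have "\<bar>ip F (\<lambda>i. v i - v' i) u'\<bar> \<le> K * norm (J u') * norm (J v - J v')"
      using bnd[OF c00_diff[OF c(2,4)] c(3)] c by (simp add: J_diff mult_ac)
    ultimately show ?thesis by linarith
  qed
  have "\<exists>U. \<forall>x\<in>X. (\<forall>n. U x n \<in> c00) \<and> (\<lambda>n. J (U x n)) \<longlonglongrightarrow> x"
    using approximating_sequence by (intro bchoice) blast
  then obtain U where U: "\<And>x n. x \<in> X \<Longrightarrow> U x n \<in> c00" "\<And>x. x \<in> X \<Longrightarrow> (\<lambda>n. J (U x n)) \<longlonglongrightarrow> x"
    by blast
  have conv: "\<exists>l. (\<lambda>n. ip F (U x n) (U y n)) \<longlonglongrightarrow> l" if xy: "x \<in> X" "y \<in> X" for x y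
  proof -
    define f g where "f = (\<lambda>n. J (U x n))" and "g = (\<lambda>n. J (U y n))"
    have fg: "f \<longlonglongrightarrow> x" "g \<longlonglongrightarrow> y" using U xy by (auto simp: f_def g_def)
    obtain b1 b2 where b: "\<And>n. norm (f n) \<le> b1" "\<And>n. norm (g n) \<le> b2"
      using convergent_imp_Bseq[OF convergentI[OF fg(1)]] convergent_imp_Bseq[OF convergentI[OF fg(2)]]
      unfolding Bseq_def by blast
    have b0: "0 \<le> b1" "0 \<le> b2" using b[of 0] by (meson norm_ge_zero order_trans)+
    have "Cauchy (\<lambda>n. ip F (U x n) (U y n))"
    proof (rule metric_CauchyI)
      fix e :: real assume e: "e > 0"
      \<comment> \<open>Chosen such that \<open>K * d * (b1 + b2) < e\<close>; the added 1 makes the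
        inequality strict and the denominator positive.\<close>
      define d where "d = e / (K * (b1 + b2 + 1))"
      have d: "d > 0" using e K b0 by (simp add: d_def)
      obtain N1 where N1: "\<And>m n. m \<ge> N1 \<Longrightarrow> n \<ge> N1 \<Longrightarrow> norm (f m - f n) < d"
        using LIMSEQ_imp_Cauchy[OF fg(1)] d unfolding Cauchy_iff by metis
      obtain N2 where N2: "\<And>m n. m \<ge> N2 \<Longrightarrow> n \<ge> N2 \<Longrightarrow> norm (g m - g n) < d"
        using LIMSEQ_imp_Cauchy[OF fg(2)] d unfolding Cauchy_iff by metis
      have "dist (ip F (U x k) (U y k)) (ip F (U x n) (U y n)) < e" if k: "k \<ge> max N1 N2" "n \<ge> max N1 N2" for k n
      proof -
        have "dist (ip F (U x k) (U y k)) (ip F (U x n) (U y n))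
            \<le> K * norm (f k - f n) * norm (g k) + K * norm (f n) * norm (g k - g n)"
          unfolding dist_real_def f_def g_def using U(1) xy by (intro diff) auto
        also have "\<dots> \<le> K * d * b2 + K * b1 * d"
          using N1[of k n] N2[of k n] k K b b0 d
          by (intro add_mono mult_mono) (auto intro: less_imp_le mult_nonneg_nonneg)
        also have "\<dots> = K * d * (b1 + b2)" by (simp add: algebra_simps)
        also have "\<dots> < K * d * (b1 + b2 + 1)" using K d by (intro mult_strict_left_mono) auto
        also have "\<dots> = e"
        proof -
          have "b1 + b2 + 1 \<noteq> 0" using b0 by linarith
          then show ?thesis using K by (simp add: d_def)
        qed
        finally show ?thesis .
      qed
      then show "\<exists>N. \<forall>k\<ge>N. \<forall>n\<ge>N. dist (ip F (U x k) (U y k)) (ip F (U x n) (U y n)) < e" by blast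
    qed
    then show ?thesis by (simp add: Cauchy_convergent convergentD)
  qed
  define B where "B = (\<lambda>x y. lim (\<lambda>n. ip F (U x n) (U y n)))"
  have B_U: "(\<lambda>n. ip F (U x n) (U y n)) \<longlonglongrightarrow> B x y" if "x \<in> X" "y \<in> X" for x y
    using conv[OF that] limI unfolding B_def by blast
  have B: "(\<lambda>n. ip F (u n) (v n)) \<longlonglongrightarrow> B x y"
    if xy: "x \<in> X" "y \<in> X" and uv: "\<And>n. u n \<in> c00" "\<And>n. v n \<in> c00" "(\<lambda>n. J (u n)) \<longlonglongrightarrow> x" "(\<lambda>n. J (v n)) \<longlonglongrightarrow> y"
    for x y u v
  proof -
    define h where "h = (\<lambda>n. K * norm (J (u n) - J (U x n)) * norm (J (v n))
        + K * norm (J (U x n)) * norm (J (v n) - J (U y n)))"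
    have "h \<longlonglongrightarrow> K * norm (x - x) * norm y + K * norm x * norm (y - y)"
      unfolding h_def by (intro tendsto_intros uv U xy)
    then have h0: "h \<longlonglongrightarrow> 0" by simp
    have "(\<lambda>n. ip F (u n) (v n) - ip F (U x n) (U y n)) \<longlonglongrightarrow> 0"
      by (rule Lim_null_comparison[OF _ h0]) (use diff uv U(1) xy in \<open>simp add: h_def\<close>)
    from tendsto_add[OF this B_U[OF xy]] show ?thesis by simp
  qed
  have sub: "subspace X"
    unfolding X_eq
  proof (rule subspace_closure)
    show "subspace (J ` c00)"
      unfolding subspace_def
    proof (intro conjI ballI allI)
      show "0 \<in> J ` c00" using imageI[OF c00_zero, of J] by (simp add: J_zero)
      show "z + w \<in> J ` c00" if "z \<in> J ` c00" "w \<in> J ` c00" for z w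
        using that by (auto simp flip: J_add intro!: imageI c00_add)
      show "r *\<^sub>R z \<in> J ` c00" if "z \<in> J ` c00" for r z
        using that by (auto simp flip: J_scale intro!: imageI c00_scale)
    qed
  qed
  have "bounded_form X B K"
  proof
    show "subspace X" by (rule sub)
    show "K > 0" by (rule K)
  next
    fix x y z assume x: "x \<in> X" and y: "y \<in> X" and z: "z \<in> X"
    have "(\<lambda>n. ip F (\<lambda>i. U x n i + U y n i) (U z n)) \<longlonglongrightarrow> B (x + y) z"
      using x y z sub by (intro B) (auto simp: J_add U c00_add subspace_add intro: tendsto_add)
    moreover have "(\<lambda>n. ip F (\<lambda>i. U x n i + U y n i) (U z n)) \<longlonglongrightarrow> B x z + B y z"
      using tendsto_add[OF B_U[OF x z] B_U[OF y z]] x y by (simp add: ip_add U)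
    ultimately show "B (x + y) z = B x z + B y z" by (rule LIMSEQ_unique)
  next
    fix x z and r :: real assume x: "x \<in> X" and z: "z \<in> X"
    have "(\<lambda>n. ip F (\<lambda>i. r * U x n i) (U z n)) \<longlonglongrightarrow> B (r *\<^sub>R x) z"
      using x z sub by (intro B) (auto simp: J_scale U c00_scale subspace_scale intro: tendsto_scaleR)
    moreover have "(\<lambda>n. ip F (\<lambda>i. r * U x n i) (U z n)) \<longlonglongrightarrow> r * B x z"
      unfolding ip_scale by (intro tendsto_mult tendsto_const B_U x z)
    ultimately show "B (r *\<^sub>R x) z = r * B x z" by (rule LIMSEQ_unique)
  next
    fix x y assume x: "x \<in> X" and y: "y \<in> X"
    have "(\<lambda>n. ip F (U x n) (U y n)) \<longlonglongrightarrow> B y x"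
      using B_U[OF y x] ip_sym U(1) x y by simp
    then show "B x y = B y x" using B_U[OF x y] LIMSEQ_unique by blast
    have "(\<lambda>n. \<bar>ip F (U x n) (U y n)\<bar>) \<longlonglongrightarrow> \<bar>B x y\<bar>" by (intro tendsto_rabs B_U x y)
    moreover have "(\<lambda>n. K * norm (J (U x n)) * norm (J (U y n))) \<longlonglongrightarrow> K * norm x * norm y"
      by (intro tendsto_intros U x y)
    ultimately show "\<bar>B x y\<bar> \<le> K * norm x * norm y"
      by (rule LIMSEQ_le) (use bnd U(1) x y in auto)
  next
    fix x assume x: "x \<in> X"
    show "0 \<le> B x x"
      by (rule LIMSEQ_le_const[OF B_U[OF x x]]) (auto simp: ip_self sq_nonneg)
  qed
  moreover have "(\<lambda>n. sq F (u n)) \<longlonglongrightarrow> B x x"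
    if "x \<in> X" "\<forall>n. u n \<in> c00" "(\<lambda>n. J (u n)) \<longlonglongrightarrow> x" for x u
    using B[of x x u u] that by (simp add: ip_self)
  ultimately show ?thesis by blast
qed

text \<open>Finitely supported approximants stand in for unit vectors of \<open>Y\<close>, since
  \<open>Y\<close> may contain no image of a nonzero finitely supported vector.\<close>

definition near :: "'a set \<Rightarrow> nat set \<Rightarrow> real \<Rightarrow> (nat \<Rightarrow> real) \<Rightarrow> bool" where
  "near Y F e x \<longleftrightarrow> x \<in> c00 \<and> (\<exists>y\<in>Y. norm y = 1 \<and> norm (J x - y) < e) \<and> sq F x < e\<^sup>2"

lemma dense_range_J: "X \<subseteq> closure (span (range (\<lambda>i. J (\<lambda>k. if k = i then 1 else 0))))"
proof -
  have "J x \<in> span (range (\<lambda>i. J (\<lambda>k. if k = i then 1 else 0)))" if x: "x \<in> c00" for x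
  proof -
    have "x = (\<lambda>k. \<Sum>i | x i \<noteq> 0. x i * (if k = i then 1 else 0))"
      using c00D[OF x] by (auto simp: if_distrib cong: if_cong)
    then have "J x = J (\<lambda>k. \<Sum>i | x i \<noteq> 0. x i * (if k = i then 1 else 0))" by (rule arg_cong)
    also have "\<dots> = (\<Sum>i | x i \<noteq> 0. x i *\<^sub>R J (\<lambda>k. if k = i then 1 else 0))"
      using c00D[OF x] by (intro J_sum) (auto simp: c00_def)
    also have "\<dots> \<in> span (range (\<lambda>i. J (\<lambda>k. if k = i then 1 else 0)))"
      by (intro span_sum span_scale span_base) auto
    finally show ?thesis .
  qed
  then show ?thesis unfolding X_eq by (intro closure_mono) auto
qed

text \<open>The absence of \<open>near\<close> vectors says that restriction to \<open>F\<close> is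
  bounded below by \<open>e\<close> on the unit sphere of \<open>Y\<close>, so the extended form is
  coercive on \<open>Y\<close> with constant \<open>e\<^sup>2\<close>.\<close>

lemma hilbertian_subspace:
  assumes F: "hilbertian F" and e: "e > 0" and far: "\<nexists>x. near Y F e x"
    and Y: "subspace Y" "closed Y" "Y \<subseteq> X" and inf: "infinite_dimensional Y"
  shows "complemented_in X Y \<and> isomorphic_to_lp 2 Y"
proof -
  obtain K0 where K0: "\<And>x. x \<in> c00 \<Longrightarrow> sq F x \<le> K0 * (nrm x)\<^sup>2"
    using F unfolding hilbertian_def by blast
  define K where "K = max K0 1"
  have K: "K > 0" "\<And>x. x \<in> c00 \<Longrightarrow> sq F x \<le> K * (nrm x)\<^sup>2"
  proof -
    show "K > 0" by (simp add: K_def)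
    show "sq F x \<le> K * (nrm x)\<^sup>2" if "x \<in> c00" for x
      using K0[OF that] mult_right_mono[of K0 K "(nrm x)\<^sup>2"] by (simp add: K_def)
  qed
  obtain B where form: "bounded_form X B K"
    and B: "\<And>x u. \<lbrakk>x \<in> X; \<forall>n. u n \<in> c00; (\<lambda>n. J (u n)) \<longlonglongrightarrow> x\<rbrakk> \<Longrightarrow> (\<lambda>n. sq F (u n)) \<longlonglongrightarrow> B x x"
    using form_exists[OF K] by blast
  interpret bounded_form X B K by (rule form)
  have unit: "e\<^sup>2 \<le> B y y" if y: "y \<in> Y" "norm y = 1" for y
  proof -
    have yX: "y \<in> X" using y Y(3) by blast
    obtain u where u: "\<And>n. u n \<in> c00" and lim: "(\<lambda>n. J (u n)) \<longlonglongrightarrow> y"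
      using approximating_sequence[OF yX] by blast
    have "(\<lambda>n. sq F (u n)) \<longlonglongrightarrow> B y y" using u by (intro B[OF yX _ lim]) auto
    \<comment> \<open>As soon as \<open>J (u n)\<close> is within \<open>e\<close> of the unit
      vector \<open>y\<close>, the only condition of \<open>near\<close> that can fail is smallness
      on \<open>F\<close>.\<close>
    moreover have "\<exists>N. \<forall>n\<ge>N. e\<^sup>2 \<le> sq F (u n)"
    proof -
      obtain N where N: "\<And>n. n \<ge> N \<Longrightarrow> norm (J (u n) - y) < e" using LIMSEQ_D[OF lim e] by blast
      have "e\<^sup>2 \<le> sq F (u n)" if "n \<ge> N" for n
        using far N[OF that] u[of n] y unfolding near_def by (meson not_le)
      then show ?thesis by blast
    qed
    ultimately show ?thesis by (rule LIMSEQ_le_const)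
  qed
  interpret coercive_form X B K Y "e\<^sup>2"
  proof
    show "e\<^sup>2 > 0" using e by simp
    fix y assume y: "y \<in> Y"
    show "e\<^sup>2 * (norm y)\<^sup>2 \<le> B y y"
    proof (cases "y = 0")
      case False
      define r where "r = inverse (norm y)"
      have r: "r > 0" using False by (simp add: r_def)
      have "e\<^sup>2 \<le> B (r *\<^sub>R y) (r *\<^sub>R y)"
        using y Y(1) False by (intro unit) (auto simp: subspace_scale r_def)
      also have "\<dots> = r\<^sup>2 * B y y"
        using y Y(3) by (simp add: scale_left scale_right subsetD power2_eq_square mult.assoc)
      finally show ?thesis using False by (simp add: r_def field_simps)
    qed simp
  qed (use Y in auto)
  obtain P where P: "lin_on X P" "P ` X = Y" "\<And>x. x \<in> X \<Longrightarrow> P (P x) = P x"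
    and bdd: "\<exists>C. \<forall>x\<in>X. norm (P x) \<le> C * norm x"
    using complemented unfolding complemented_in_def by blast
  obtain C where C: "\<And>x. x \<in> X \<Longrightarrow> norm (P x) \<le> C * norm x" using bdd by blast
  define b where "b = (\<lambda>i. J (\<lambda>k. if k = i then 1 else 0))"
  have bX: "b i \<in> X" for i
  proof -
    have "J ` c00 \<subseteq> X" unfolding X_eq by (rule closure_subset)
    moreover have "b i \<in> J ` c00" unfolding b_def by (rule imageI) (simp add: c00_def)
    ultimately show ?thesis by (rule subsetD)
  qed
  have P_add: "P (x + y) = P x + P y" if "x \<in> X" "y \<in> X" for x y
    using P(1) that by (simp add: lin_on_def)
  have P_scale: "P (r *\<^sub>R x) = r *\<^sub>R P x" if "x \<in> X" for x r
    using P(1) that by (simp add: lin_on_def)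
  have span: "z \<in> X \<and> P z \<in> span (range (\<lambda>i. P (b i)))" if "z \<in> span (range b)" for z
    using that
  proof (induction rule: span_induct_alt)
    case base
    have "P 0 = 0" using P_scale[of 0 0] by simp
    then show ?case by (simp add: span_zero)
  next
    case (step r w z)
    then obtain i where w: "w = b i" by blast
    have "P (r *\<^sub>R w + z) = r *\<^sub>R P (b i) + P z"
      using step.IH bX by (simp add: w P_add P_scale)
    also have "\<dots> \<in> span (range (\<lambda>i. P (b i)))"
      using step.IH by (intro span_add span_scale) (auto intro: span_base)
    finally show ?case using step.IH bX w by auto
  qed
  \<comment> \<open>\<open>isomorphic_to_l2\<close> asks for a sequence inside \<open>Y\<close>. The
    unit vectors \<open>b i\<close> need not lie there, but their projections do, and continuity of
    \<open>P\<close> keeps the span dense.\<close>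
  have "Y \<subseteq> closure (span (range (\<lambda>i. P (b i))))"
  proof
    fix y assume y: "y \<in> Y"
    then obtain x where x: "x \<in> X" "y = P x" using P(2) by blast
    then have Py: "P y = y" and yX: "y \<in> X" using P(3) y Y(3) by auto
    then have "y \<in> closure (span (range b))" using dense_range_J unfolding b_def by blast
    then obtain z where z: "\<And>n. z n \<in> span (range b)" "z \<longlonglongrightarrow> y"
      unfolding closure_sequential by blast
    have diffP: "norm (P (z n) - y) \<le> C * norm (z n - y)" for n
    proof -
      have zX: "z n \<in> X" "z n - y \<in> X" using span[OF z(1)] yX by auto
      have "P (z n) = P ((z n - y) + y)" by simp
      also have "\<dots> = P (z n - y) + P y" using zX yX by (intro P_add)
      finally show ?thesis using C[OF zX(2)] Py by simp
    qed
    have lim0: "(\<lambda>n. C * norm (z n - y)) \<longlonglongrightarrow> 0"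
      using tendsto_mult[OF tendsto_const[of C] tendsto_norm[OF LIM_zero[OF z(2)]]] by simp
    have "(\<lambda>n. P (z n) - y) \<longlonglongrightarrow> 0"
      by (rule Lim_null_comparison[OF _ lim0]) (simp add: diffP)
    then have "(\<lambda>n. P (z n)) \<longlonglongrightarrow> y" by (simp add: LIM_zero_iff)
    then show "y \<in> closure (span (range (\<lambda>i. P (b i))))"
      unfolding closure_sequential using span[OF z(1)] by (intro exI[of _ "\<lambda>n. P (z n)"]) simp
  qed
  moreover have "P (b i) \<in> Y" for i using P(2) bX by blast
  ultimately show ?thesis using complemented isomorphic_to_l2[of "\<lambda>i. P (b i)"] inf by blast
qed

section \<open>Subspaces containing \<open>\<ell>\<^sub>p\<close>\<close>


lemma near_mono:
  assumes "near Y F e x" "F' \<subseteq> F" "e \<le> e'" "0 < e"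
  shows "near Y F' e' x"
proof -
  have x: "x \<in> c00" using assms(1) by (simp add: near_def)
  have "sq F' x \<le> sq F x" by (rule sq_mono[OF x assms(2)])
  also have "\<dots> < e\<^sup>2" using assms(1) by (simp add: near_def)
  also have "\<dots> \<le> e'\<^sup>2" using assms by (intro power_mono) auto
  finally have "sq F' x < e'\<^sup>2" .
  moreover obtain y where "y \<in> Y" "norm y = 1" "norm (J x - y) < e"
    using assms(1) unfolding near_def by blast
  moreover from this have "norm (J x - y) < e'" using assms(3) by linarith
  ultimately show ?thesis using x unfolding near_def by blast
qed

lemma near_norm_le:
  assumes "near Y F e x" "e \<le> 1"
  shows "nrm x \<le> 2"
proof -
  obtain y where x: "x \<in> c00" and y: "norm y = 1" "norm (J x - y) < e"
    using assms(1) unfolding near_def by blast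
  have "norm (J x) \<le> norm y + norm (J x - y)" by (rule norm_triangle_sub)
  then show ?thesis using y assms(2) by (simp add: norm_J x)
qed

lemma hilbertian_Union:
  assumes "finite \<F>" "\<And>F. F \<in> \<F> \<Longrightarrow> hilbertian F"
  shows "hilbertian (\<Union>\<F>)"
  using assms
  by (induction \<F> rule: finite_induct) (simp_all add: hilbertian_Un hilbertian_finite)

section \<open>Cluster points of the subtree norms\<close>

definition cluster :: "'a set \<Rightarrow> (nat \<Rightarrow> real) \<Rightarrow> bool" where
  "cluster Y m \<longleftrightarrow> (\<forall>F e G. hilbertian F \<longrightarrow> 0 < e \<longrightarrow> finite G \<longrightarrow>
     (\<exists>x. near Y F e x \<and> (\<forall>t\<in>G. \<bar>nrm (mask {s. le t s} x) - m t\<bar> < e)))"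

text \<open>The closed sets \<open>C i\<close> have the finite intersection property: finitely many
  demands are met together by the union of the hilbertian sets and the least tolerance. The
  functions \<open>\<Phi> x\<close> range in a compact product of intervals.\<close>

lemma cluster_exists:
  assumes ex: "\<And>F e. hilbertian F \<Longrightarrow> 0 < e \<Longrightarrow> \<exists>x. near Y F e x"
  shows "\<exists>m. cluster Y m"
proof -
  define \<Phi> where "\<Phi> = (\<lambda>x t. nrm (mask {s. le t s} x))"
  \<comment> \<open>Tolerances are capped at 1 so that \<open>near_norm_le\<close> bounds the
    vectors by 2, which fixes the interval in \<open>Q\<close>.\<close>
  define I where "I = {(F, e). hilbertian F \<and> 0 < e \<and> e \<le> (1::real)}"
  define C where "C = (\<lambda>i. closure (\<Phi> ` {x. near Y (fst i) (snd i) x}))"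
  define Q where "Q = (PiE UNIV (\<lambda>_. {0..2}) :: (nat \<Rightarrow> real) set)"
  have "compactin (product_topology (\<lambda>_. euclidean) UNIV) Q"
    unfolding Q_def by (simp add: compactin_PiE)
  then have "compact Q" by (simp add: euclidean_product_topology)
  then have "Q \<inter> (\<Inter>i\<in>I. C i) \<noteq> {}"
  proof (rule compact_imp_fip_image)
    show "closed (C i)" for i by (simp add: C_def)
    fix I' assume I': "finite I'" "I' \<subseteq> I"
    \<comment> \<open>The inserted 1 provides a tolerance when \<open>I'\<close> is empty.\<close>
    define F e where "F = \<Union>(fst ` I')" and "e = Min (insert 1 (snd ` I'))"
    have "hilbertian F" unfolding F_def using I' by (intro hilbertian_Union) (auto simp: I_def)
    moreover have e: "0 < e" "e \<le> 1" using I' by (auto simp: e_def I_def)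
    ultimately obtain x where x: "near Y F e x" using ex by blast
    have "near Y (fst i) (snd i) x" if "i \<in> I'" for i
      using I' that by (intro near_mono[OF x _ _ e(1)]) (auto simp: F_def e_def)
    then have "\<Phi> x \<in> (\<Inter>i\<in>I'. C i)"
      unfolding C_def by (intro INT_I subsetD[OF closure_subset] imageI) simp
    moreover have "\<Phi> x t \<in> {0..2}" for t
    proof -
      have "x \<in> c00" using x by (simp add: near_def)
      then show ?thesis
        using norm_mask_le[of x "{s. le t s}"] near_norm_le[OF x e(2)] norm_nonneg[OF c00_mask, of x "{s. le t s}"]
        by (simp add: \<Phi>_def)
    qed
    then have "\<Phi> x \<in> Q" by (simp add: Q_def PiE_iff)
    ultimately show "Q \<inter> (\<Inter>i\<in>I'. C i) \<noteq> {}" by blast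
  qed
  then obtain m where m: "\<And>i. i \<in> I \<Longrightarrow> m \<in> C i" by blast
  have "\<exists>x. near Y F e x \<and> (\<forall>t\<in>G. \<bar>\<Phi> x t - m t\<bar> < e)"
    if F: "hilbertian F" and e: "0 < e" and G: "finite G" for F e G
  proof -
    define e' where "e' = min e 1"
    have e': "0 < e'" "e' \<le> e" "e' \<le> 1" using e by (auto simp: e'_def)
    define U where "U = (\<Inter>t\<in>G. (\<lambda>f :: nat \<Rightarrow> real. f t) -` {m t - e<..<m t + e})"
    have "open U"
      unfolding U_def using G
      by (intro open_INT ballI open_vimage continuous_on_product_coordinates) auto
    moreover have "m \<in> U" using e by (simp add: U_def)
    moreover have "m \<in> closure (\<Phi> ` {x. near Y F e' x})"
      using m[of "(F, e')"] F e' by (simp add: I_def C_def)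
    ultimately have "U \<inter> \<Phi> ` {x. near Y F e' x} \<noteq> {}"
      using open_Int_closure_eq_empty[of U] by blast
    then obtain x where x: "near Y F e' x" "\<Phi> x \<in> U" by blast
    have "\<bar>\<Phi> x t - m t\<bar> < e" if "t \<in> G" for t
    proof -
      have "\<Phi> x t \<in> {m t - e<..<m t + e}" using x(2) that unfolding U_def by auto
      then show ?thesis by auto
    qed
    moreover have "near Y F e x" using near_mono[OF x(1) subset_refl e'(2,1)] .
    ultimately show ?thesis by blast
  qed
  then show ?thesis unfolding cluster_def \<Phi>_def by blast
qed

lemma clusterD:
  assumes "cluster Y m" "hilbertian F" "0 < e" "finite G"
  shows "\<exists>x. near Y F e x \<and> (\<forall>t\<in>G. \<bar>nrm (mask {s. le t s} x) - m t\<bar> < e)"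
  using assms unfolding cluster_def by blast

text \<open>One vector \<open>x\<close> approximates \<open>m\<close> on a whole finite antichain,
  so all its subtree norms there are at least \<open>d / 2\<close>. The subtrees are disjoint, as
  two nodes below a common node are comparable, and
  \<open>card A * (d / 2) powr p \<le> 2 powr p\<close> yields \<open>K\<close>.\<close>

lemma hilbertian_level:
  assumes m: "cluster Y m" and d: "0 < d"
  shows "hilbertian {t. d \<le> m t}"
proof (rule hilbertian_narrow[where K = "nat \<lfloor>(4 / d) powr p\<rfloor>"])
  fix A assume A: "finite A" "A \<subseteq> {t. d \<le> m t}" and anti: "\<forall>s\<in>A. \<forall>t\<in>A. le s t \<longrightarrow> s = t"
  define e where "e = min (d / 2) 1"
  have e: "0 < e" "e \<le> d / 2" "e \<le> 1" using d by (auto simp: e_def)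
  obtain x where x: "near Y {} e x"
    and close: "\<And>t. t \<in> A \<Longrightarrow> \<bar>nrm (mask {s. le t s} x) - m t\<bar> < e"
    using clusterD[OF m hilbertian_finite[OF finite.emptyI] e(1) A(1)] by blast
  have xc: "x \<in> c00" using x by (simp add: near_def)
  have "card A * (d / 2) powr p \<le> (\<Sum>t\<in>A. nrm (mask {s. le t s} x) powr p)"
  proof (rule sum_bounded_below)
    fix t assume t: "t \<in> A"
    have "d / 2 \<le> nrm (mask {s. le t s} x)" using close[OF t] e A(2) t by auto
    then show "(d / 2) powr p \<le> nrm (mask {s. le t s} x) powr p"
      using d p_gt_2 by (intro powr_mono2) auto
  qed
  also have "\<dots> \<le> nrm x powr p"
  proof (rule sum_norm_mask_le[OF A(1) xc])
    show "tree_convex {s. le t s}" for t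
      unfolding tree_convex_def using le_trans[of t] by simp
    have "s = t" if st: "s \<in> A" "t \<in> A" "le s k" "le t k" for s t k
    proof (cases "s \<le> t")
      case True
      have "le s t" by (rule le_chain[OF st(3,4) True])
      then show ?thesis using anti st(1,2) by simp
    next
      case False
      have "le t s" by (rule le_chain[OF st(4,3)]) (use False in simp)
      then show ?thesis using anti st(1,2) by auto
    qed
    then show "disjoint_family_on (\<lambda>t. {s. le t s}) A"
      by (force simp: disjoint_family_on_def)
  qed
  also have "\<dots> \<le> 2 powr p"
    using near_norm_le[OF x e(3)] norm_nonneg[OF xc] p_gt_2 by (intro powr_mono2) auto
  also have "2 powr p = (4 / d) powr p * (d / 2) powr p"
  proof -
    have "4 / d * (d / 2) = 2" using d by simp
    then show ?thesis using powr_mult[of "4 / d" "d / 2" p] d by simp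
  qed
  finally have "card A \<le> (4 / d) powr p" using d by simp
  then show "card A \<le> nat \<lfloor>(4 / d) powr p\<rfloor>" by (rule le_nat_floor)
qed

text \<open>The vector \<open>u\<close> is taken small on the level set together with the first
  \<open>N\<close> nodes and then cut off on these. By \<open>norm_le_l2\<close> the cut costs less
  than \<open>gap N\<close>, whence \<open>2 * gap N\<close>; it decreases all moduli, so the other
  estimates survive.\<close>

lemma block_exists:
  assumes m: "cluster Y m"
  shows "\<exists>x y. x \<in> c00 \<and> (\<forall>i. x i \<noteq> 0 \<longrightarrow> N \<le> i) \<and> y \<in> Y \<and> norm y = 1 \<and>
    norm (J x - y) < 2 * gap N \<and> sq {t. gap N \<le> m t} x < (gap N)\<^sup>2 \<and>
    (\<forall>t<N. nrm (mask {s. le t s} x) \<le> m t + gap N)"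
proof -
  define D where "D = {t. gap N \<le> m t}"
  have "hilbertian (D \<union> {..<N})"
    unfolding D_def by (intro hilbertian_Un hilbertian_level[OF m] gap_pos hilbertian_finite) auto
  then obtain u where u: "near Y (D \<union> {..<N}) (gap N) u"
    and close: "\<And>t. t \<in> {..<N} \<Longrightarrow> \<bar>nrm (mask {s. le t s} u) - m t\<bar> < gap N"
    using clusterD[OF m _ gap_pos[of N] finite_lessThan[of N]] by blast
  have uc: "u \<in> c00" and squ: "sq (D \<union> {..<N}) u < (gap N)\<^sup>2" using u by (auto simp: near_def)
  obtain y where y: "y \<in> Y" "norm y = 1" "norm (J u - y) < gap N" using u unfolding near_def by blast
  define x where "x = mask {N..} u"
  have xc: "x \<in> c00" unfolding x_def by (rule c00_mask[OF uc])
  have diff: "(\<lambda>i. u i - x i) = mask {..<N} u" by (auto simp: x_def mask_def)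
  have "J u - J x = J (mask {..<N} u)" unfolding diff[symmetric] by (simp add: J_diff uc xc)
  then have "norm (J u - J x) = nrm (mask {..<N} u)" by (simp add: norm_J c00_mask uc)
  also have "\<dots> \<le> sqrt (sq UNIV (mask {..<N} u))" by (rule norm_le_l2[OF c00_mask[OF uc]])
  also have "sq UNIV (mask {..<N} u) = sq {..<N} u"
    unfolding sq_def mask_def by (rule sum.cong) auto
  also have "\<dots> \<le> sq (D \<union> {..<N}) u" by (rule sq_mono[OF uc]) auto
  also have "sqrt \<dots> < gap N"
    using squ gap_pos[of N] by (intro real_less_lsqrt) (auto simp: sq_nonneg)
  finally have "norm (J u - J x) < gap N" by simp
  then have "norm (J x - y) < 2 * gap N"
    using y(3) norm_triangle_ineq[of "J x - J u" "J u - y"] by (simp add: norm_minus_commute)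
  moreover have "sq D x < (gap N)\<^sup>2"
  proof -
    have "sq D x = (\<Sum>i | i \<in> D \<and> x i \<noteq> 0. (u i)\<^sup>2)"
      unfolding sq_def x_def mask_def by (rule sum.cong) auto
    also have "\<dots> \<le> sq D u"
      unfolding sq_def using c00D[OF uc]
      by (intro sum_mono2) (auto simp: x_def mask_def)
    also have "\<dots> \<le> sq (D \<union> {..<N}) u" by (rule sq_mono[OF uc]) auto
    finally show ?thesis using squ by linarith
  qed
  moreover have "nrm (mask {s. le t s} x) \<le> m t + gap N" if "t < N" for t
  proof -
    have "nrm (mask {s. le t s} x) \<le> nrm (mask {s. le t s} u)"
      by (rule norm_mono[OF c00_mask[OF uc]]) (auto simp: mask_def x_def)
    then show ?thesis using close[of t] that by auto
  qed
  moreover have "\<forall>i. x i \<noteq> 0 \<longrightarrow> N \<le> i" by (simp add: x_def mask_def)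
  ultimately show ?thesis using xc y(1,2) unfolding D_def by blast
qed

lemma contains_lp:
  assumes ex: "\<And>F e. hilbertian F \<Longrightarrow> 0 < e \<Longrightarrow> \<exists>x. near Y F e x"
    and Y: "subspace Y" "closed Y"
  shows "\<exists>Z. subspace Z \<and> Z \<subseteq> Y \<and> isomorphic_to_lp p Z"
proof -
  obtain m where m: "cluster Y m" using cluster_exists[OF ex] by blast
  define P where "P = (\<lambda>N x y. x \<in> c00 \<and> (\<forall>i. x i \<noteq> 0 \<longrightarrow> N \<le> i) \<and> y \<in> Y \<and> norm y = 1 \<and>
    norm (J x - y) < 2 * gap N \<and> sq {t. gap N \<le> m t} x < (gap N)\<^sup>2 \<and>
    (\<forall>t<N. nrm (mask {s. le t s} x) \<le> m t + gap N))"
  have "\<exists>x y. P N x y" for N using block_exists[OF m] unfolding P_def .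
  \<comment> \<open>The vectors depend only on the start \<open>N\<close> and not on earlier blocks,
    so one choice for all \<open>N\<close> suffices; the block starts are then the orbit of 0 under
    \<open>nx\<close>, which leads past the support of \<open>xf N\<close>.\<close>
  then obtain xf yf where P: "\<And>N. P N (xf N) (yf N)" by metis
  have xf: "\<And>N. xf N \<in> c00" "\<And>N i. xf N i \<noteq> 0 \<Longrightarrow> N \<le> i"
    and yf: "\<And>N. yf N \<in> Y" "\<And>N. norm (yf N) = 1" "\<And>N. norm (J (xf N) - yf N) < 2 * gap N"
    and heavy: "\<And>N. sq {t. gap N \<le> m t} (xf N) < (gap N)\<^sup>2"
    and light: "\<And>N t. t < N \<Longrightarrow> nrm (mask {s. le t s} (xf N)) \<le> m t + gap N"
    using P unfolding P_def by blast+
  have "\<exists>K>N. \<forall>i. xf N i \<noteq> 0 \<longrightarrow> i < K" for N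
  proof -
    obtain K where "\<forall>i\<in>{i. xf N i \<noteq> 0}. i < K"
      using c00D[OF xf(1)] finite_nat_set_iff_bounded by blast
    then show ?thesis by (intro exI[of _ "Suc (max N K)"]) (auto simp: less_Suc_eq_le max_def)
  qed
  then obtain nx where nx: "\<And>N. N < nx N" "\<And>N i. xf N i \<noteq> 0 \<Longrightarrow> i < nx N" by metis
  define M where "M = (\<lambda>n. (nx ^^ n) 0)"
  have gap_small: "2 * gap N \<le> 1 / 8" for N
    using gap_antimono[of 0 N] by (simp add: gap_def)
  have norms: "1 / 2 \<le> nrm (xf N)" "nrm (xf N) \<le> 2" for N
    using norm_triangle_ineq2[of "J (xf N)" "yf N"] norm_triangle_ineq2[of "yf N" "J (xf N)"]
      yf(2,3)[of N] gap_small[of N] norm_J[OF xf(1)]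
    by (auto simp: norm_minus_commute)
  interpret block_sequence le p J X "\<lambda>n. xf (M n)" M m
  proof
    show "strict_mono M" by (rule strict_monoI_Suc) (simp add: M_def nx)
    show "M n \<le> i \<and> i < M (Suc n)" if "xf (M n) i \<noteq> 0" for n i
      using xf(2)[OF that] nx(2)[OF that] by (simp add: M_def)
    show "nrm (mask {s. le t s} (xf (M n))) \<le> m t + gap (M n)" if "t < M n" for t n
      using that by (rule light)
  qed (rule xf(1) heavy norms)+
  have "isomorphic_to_lp p (closure (span (range (\<lambda>n. yf (M n)))))"
    using yf(3) by (intro perturbation_isomorphic_to_lp) (auto intro: less_imp_le)
  moreover have "closure (span (range (\<lambda>n. yf (M n)))) \<subseteq> Y"
    using yf(1) by (intro closure_minimal span_minimal Y) auto
  ultimately show ?thesis using subspace_closure[OF subspace_span] by blast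
qed

end

theorem theorem1p4p8:
  fixes le :: "nat \<Rightarrow> nat \<Rightarrow> bool" and p :: real
    and J :: "(nat \<Rightarrow> real) \<Rightarrow> 'a::banach" and X Y :: "'a set"
  assumes "tree_order le"
    and "2 < p"
    and "JT_space le p J X"
    and "subspace Y" and "closed Y" and "Y \<subseteq> X"
    and "infinite_dimensional Y"
    and "\<not> (\<exists>Z. subspace Z \<and> Z \<subseteq> Y \<and> isomorphic_to_lp p Z)"
  shows "complemented_in X Y \<and> isomorphic_to_lp 2 Y"
proof -
  interpret jt_embedding le p J X
    using assms(1-3) by (intro jt_embedding.intro jt_tree.intro jt_embedding_axioms.intro)
  obtain F e where "hilbertian F" "0 < e" "\<nexists>x. near Y F e x"
    using contains_lp[of Y] assms(4,5,8) by blast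
  then show ?thesis using assms(4-7) by (rule hilbertian_subspace)
qed

end
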